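(* For every $x\in\mathbb{R}^d$, the sequence $(\{nx\})_{n\ge1}$ is uniformly eutaxic in $(0,1)^d$ if and only if $x$ is badly approximable.
   Context: Fix a norm $|\cdot|$ on $\mathbb{R}^d$; $\mathcal{L}^d$ is Lebesgue measure; $|\cdot|_\infty$ is the supremum norm; $\{z\}$ denotes the coordinatewise fractional part. $\mathrm{P}_d$ is the set of real sequences $(r_n)_{n\ge1}$ with $r_{n+1}\le r_n$, $r_n\to0$ and $\sum_nr_n^d=\infty$. A sequence $(x_n)$ in $\mathbb{R}^d$ is uniformly eutaxic in an open set $U$ if for every $(r_n)\in\mathrm{P}_d$, $\mathcal{L}^d$-almost every $y\in U$ satisfies $|y-x_n|<r_n$ for infinitely many $n$. A point $x\in\mathbb{R}^d$ is badly approximable if there is $\varepsilon>0$ such that $|x-p/q|_\infty\ge\varepsilon/q^{1+1/d}$ for all $(p,q)\in\mathbb{Z}^d\times\mathbb{N}$. *)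

theory Defs
  imports "HOL-Analysis.Analysis"
begin

definition is_norm :: "('a::real_vector \<Rightarrow> real) \<Rightarrow> bool" where
  "is_norm N \<longleftrightarrow> (\<forall>x. 0 \<le> N x) \<and> (\<forall>x. N x = 0 \<longleftrightarrow> x = 0)
     \<and> (\<forall>c x. N (c *\<^sub>R x) = \<bar>c\<bar> * N x) \<and> (\<forall>x y. N (x + y) \<le> N x + N y)"

text \<open>The class P_d (sequences indexed by n \<ge> 1).\<close>
definition P_seq :: "nat \<Rightarrow> (nat \<Rightarrow> real) \<Rightarrow> bool" where
  "P_seq d r \<longleftrightarrow> (\<forall>n\<ge>1. r (Suc n) \<le> r n) \<and> r \<longlonglongrightarrow> 0
     \<and> \<not> summable (\<lambda>n. r (Suc n) ^ d)"

definition uniformly_eutaxic ::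
    "(real^'n \<Rightarrow> real) \<Rightarrow> (nat \<Rightarrow> real^'n) \<Rightarrow> (real^'n) set \<Rightarrow> bool" where
  "uniformly_eutaxic N xs U \<longleftrightarrow>
     (\<forall>r. P_seq CARD('n) r \<longrightarrow>
        (AE y in lebesgue. y \<in> U \<longrightarrow> (\<exists>\<^sub>\<infinity>n. 1 \<le> n \<and> N (y - xs n) < r n)))"

definition frac_vec :: "real^'n \<Rightarrow> real^'n" where
  "frac_vec z = (\<chi> i. frac (z $ i))"

definition badly_approximable :: "real^'n \<Rightarrow> bool" where
  "badly_approximable x \<longleftrightarrow> (\<exists>\<epsilon>>0. \<forall>(p::int^'n) (q::nat). q \<ge> 1 \<longrightarrow>
     infnorm (x - (\<chi> i. real_of_int (p $ i) / real q))
       \<ge> \<epsilon> / real q powr (1 + 1 / real CARD('n)))"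

end

theory Submission
  imports Defs
begin

text \<open>
  Write \<open>d\<close> for the dimension. If \<open>x\<close> is badly approximable, then any \<open>M\<close> consecutive points of the
  orbit are separated by a constant times \<open>M powr (- 1 / d)\<close>. A packing argument applied to the
  points \<open>n x + (i / k!) y\<close> shows that, conversely, any \<open>y\<close> lies within a constant times
  \<open>M powr (- 1 / d)\<close> of one of \<open>O(M)\<close> prescribed consecutive points of the orbit
  modulo 1. Suppose that a set of positive
  measure avoids the balls from some index on, and enclose it in an open set of nearly the same measure.
  Consider geometric blocks of indices with a large ratio. By separation, as long as the total
  volume of the balls used so far is small, at least half of the balls of the next block that lie in the
  open set are disjoint from all the previous ones. As the total volume diverges, the balls cover a
  fixed proportion of the open set, a contradiction.

  If \<open>x\<close> is not badly approximable, choose denominators \<open>q k\<close> with extremely good approximation.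
  The first \<open>2 ^ (d k) * q k\<close> points of the orbit then cluster around the first \<open>q k\<close> of them, so for radii
  \<open>q k powr (- 1 / d) / 2 ^ k\<close> on this block the balls have total volume bounded below, but their union has
  summable measure, and Borel--Cantelli applies.
\<close>

section \<open>Cubes, packing and integer translates\<close>

text \<open>Open balls of the supremum norm, that is, boxes of side \<open>2 * \<rho>\<close>. They
  stand in for the balls of \<open>N\<close>, since their volume is explicit and the two norms are
  comparable.\<close>

definition cube :: "real^'n \<Rightarrow> real \<Rightarrow> (real^'n) set" where
  "cube c \<rho> = {y. infnorm (y - c) < \<rho>}"

definition int_vec :: "int^'n \<Rightarrow> real^'n" where
  "int_vec p = (\<chi> i. of_int (p $ i))"

text \<open>The typical spacing of \<open>q\<close> evenly spread points in the unit cube. The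
  dimension enters through a type token, as the value itself does not carry it.\<close>

definition inv_root :: "'n::finite itself \<Rightarrow> nat \<Rightarrow> real" where
  "inv_root _ q = real q powr (- (1 / real CARD('n)))"

lemma infnorm_less_iff:
  fixes v :: "real^'n"
  shows "infnorm v < \<rho> \<longleftrightarrow> (\<forall>i. \<bar>v $ i\<bar> < \<rho>)"
proof -
  have fin: "finite {\<bar>v $ i\<bar> |i. i \<in> UNIV}" by (rule finite_imageI[OF finite, folded Setcompr_eq_image])
  have ne: "{\<bar>v $ i\<bar> |i. i \<in> UNIV} \<noteq> {}" by auto
  have "infnorm v < \<rho> \<longleftrightarrow> (\<forall>a\<in>{\<bar>v $ i\<bar> |i. i \<in> UNIV}. a < \<rho>)"
    unfolding infnorm_cart using finite_Sup_less_iff[OF fin ne] by blast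
  then show ?thesis by auto
qed

lemma infnorm_diff_triangle:
  fixes u v w :: "real^'n"
  shows "infnorm (u - w) \<le> infnorm (u - v) + infnorm (v - w)"
  using infnorm_triangle[of "u - v" "v - w"] by simp

lemma cube_eq_box: "cube c \<rho> = box (c - vec \<rho>) (c + vec \<rho>)"
  unfolding cube_def infnorm_less_iff mem_box_cart set_eq_iff
  by (auto simp: abs_less_iff) (smt (verit))+

lemma cube_lmeasurable [simp, intro]: "cube c \<rho> \<in> lmeasurable"
  by (simp add: cube_eq_box)

lemma measure_cube:
  fixes c :: "real^'n"
  assumes "0 \<le> \<rho>"
  shows "measure lebesgue (cube c \<rho>) = (2 * \<rho>) ^ CARD('n)"
proof -
  have "measure lebesgue (cube c \<rho>) = measure lebesgue (cbox (c - vec \<rho>) (c + vec \<rho>))"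
    unfolding cube_eq_box by (simp add: measure_lborel_box_eq measure_lborel_cbox_eq)
  also have "\<dots> = (\<Prod>i\<in>(UNIV :: 'n set). (c + vec \<rho>) $ i - (c - vec \<rho>) $ i)"
  proof -
    have "cbox (c - vec \<rho>) (c + vec \<rho>) \<noteq> {}"
      using assms by (simp add: interval_ne_empty_cart)
    from content_cbox_cart[OF this] show ?thesis by simp
  qed
  also have "\<dots> = (2 * \<rho>) ^ CARD('n)" by simp
  finally show ?thesis .
qed

lemma cube_subset:
  assumes "infnorm (u - v) + r \<le> s"
  shows "cube u r \<subseteq> cube v s"
proof
  fix y assume "y \<in> cube u r"
  then show "y \<in> cube v s"
    using assms infnorm_diff_triangle[of y v u] by (simp add: cube_def)
qed

lemma cube_Int_imp:
  assumes "cube u r \<inter> cube v s \<noteq> {}"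
  shows "infnorm (u - v) < r + s"
proof -
  obtain y where "infnorm (y - u) < r" "infnorm (y - v) < s"
    using assms by (auto simp: cube_def)
  then show ?thesis
    using infnorm_diff_triangle[of u v y] infnorm_sub[of y u] by simp
qed

text \<open>Openness keeps the cubes disjoint even at the borderline distance
  \<open>2 * \<rho>\<close> of the centres.\<close>

lemma measure_disjoint_cubes:
  fixes c :: "'i \<Rightarrow> real^'n"
  assumes "finite I" "0 \<le> \<rho>"
    and sep: "\<And>i j. i \<in> I \<Longrightarrow> j \<in> I \<Longrightarrow> i \<noteq> j \<Longrightarrow> 2 * \<rho> \<le> infnorm (c i - c j)"
  shows "measure lebesgue (\<Union>i\<in>I. cube (c i) \<rho>) = real (card I) * (2 * \<rho>) ^ CARD('n)"
proof -
  have "disjoint_family_on (\<lambda>i. cube (c i) \<rho>) I"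
    unfolding disjoint_family_on_def using sep cube_Int_imp by fastforce
  then have "measure lebesgue (\<Union>i\<in>I. cube (c i) \<rho>) = (\<Sum>i\<in>I. measure lebesgue (cube (c i) \<rho>))"
    using \<open>finite I\<close> by (intro measure_finite_Union) (auto simp: fmeasurableD fmeasurableD2[OF cube_lmeasurable] simp del: emeasure_completion)
  then show ?thesis using assms by (simp add: measure_cube)
qed

text \<open>Volume comparison: the cubes of radius \<open>\<delta> / 2\<close> are disjoint, lie in
  \<open>S\<close>, and have volume \<open>\<delta> ^ d\<close> each.\<close>

lemma packing:
  fixes f :: "'i \<Rightarrow> real^'n"
  assumes "finite I" "0 < \<delta>" and S: "S \<in> lmeasurable"
    and sep: "\<And>i j. i \<in> I \<Longrightarrow> j \<in> I \<Longrightarrow> i \<noteq> j \<Longrightarrow> \<delta> \<le> infnorm (f i - f j)"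
    and sub: "\<And>i. i \<in> I \<Longrightarrow> cube (f i) (\<delta> / 2) \<subseteq> S"
  shows "real (card I) * \<delta> ^ CARD('n) \<le> measure lebesgue S"
proof -
  have "measure lebesgue (\<Union>i\<in>I. cube (f i) (\<delta> / 2)) = real (card I) * (2 * (\<delta> / 2)) ^ CARD('n)"
    using assms by (intro measure_disjoint_cubes) auto
  also have "\<dots> = real (card I) * \<delta> ^ CARD('n)" by simp
  finally show ?thesis
    using measure_mono_fmeasurable[of "\<Union>i\<in>I. cube (f i) (\<delta> / 2)" S lebesgue] S sub \<open>finite I\<close>
    by (fastforce intro: fmeasurableD sets.finite_UN)
qed

section \<open>Integer parts and packing modulo 1\<close>

lemma frac_vec_eq: "frac_vec v = v - int_vec (\<chi> i. \<lfloor>v $ i\<rfloor>)"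
  by (simp add: frac_vec_def int_vec_def vec_eq_iff frac_def)

lemma frac_vec_obtain:
  obtains p where "frac_vec v = v - int_vec p"
  using frac_vec_eq by blast

lemma int_vec_add: "int_vec (p + q) = int_vec p + int_vec q"
  and int_vec_diff: "int_vec (p - q) = int_vec p - int_vec q"
  and int_vec_minus: "int_vec (- p) = - int_vec p"
  by (simp_all add: int_vec_def vec_eq_iff)

lemma int_vec_scale: "int_vec (\<chi> i. g * p $ i) = of_int g *\<^sub>R int_vec p"
  by (simp add: int_vec_def vec_eq_iff)

text \<open>Used to recognise an integer translate of an orbit point that lands in the open unit
  cube as an actual term of the sequence.\<close>

lemma frac_vec_unique:
  assumes "\<And>i. 0 < (v - int_vec p) $ i \<and> (v - int_vec p) $ i < 1"
  shows "frac_vec v = v - int_vec p"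
proof -
  have "frac (v $ i) = v $ i - of_int (p $ i)" for i
    using assms[of i] by (auto simp: frac_unique_iff int_vec_def)
  then show ?thesis by (simp add: frac_vec_def int_vec_def vec_eq_iff)
qed

text \<open>Fractional parts inherit the separation, because their differences agree with those of
  \<open>f\<close> up to an integer vector. As \<open>\<delta> \<le> 1\<close>, the cubes of radius
  \<open>\<delta> / 2\<close> about them fit into one cube of side 2, and \<open>packing\<close>
  applies.\<close>

lemma torus_packing:
  fixes f :: "'i \<Rightarrow> real^'n"
  assumes "finite I" "0 < \<delta>" "\<delta> \<le> 1"
    and sep: "\<And>i j p. i \<in> I \<Longrightarrow> j \<in> I \<Longrightarrow> i \<noteq> j \<Longrightarrow> \<delta> \<le> infnorm (f i - f j - int_vec p)"
  shows "real (card I) * \<delta> ^ CARD('n) \<le> 2 ^ CARD('n)"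
proof -
  have "real (card I) * \<delta> ^ CARD('n) \<le> measure lebesgue (cube (vec (1/2) :: real^'n) 1)"
  proof (rule packing[where f = "\<lambda>i. frac_vec (f i)"])
    fix i j assume *: "i \<in> I" "j \<in> I" "i \<noteq> j"
    obtain p q where "frac_vec (f i) = f i - int_vec p" "frac_vec (f j) = f j - int_vec q"
      by (metis frac_vec_obtain)
    then show "\<delta> \<le> infnorm (frac_vec (f i) - frac_vec (f j))"
      using sep[OF *, of "p - q"] by (simp add: int_vec_diff diff_diff_eq2 add_diff_eq diff_diff_add ac_simps)
  next
    fix i
    have "\<bar>y $ l - 1/2\<bar> < 1" if "\<bar>y $ l - frac (f i $ l)\<bar> < \<delta> / 2" for y :: "real^'n" and l
      using that frac_lt_1[of "f i $ l"] frac_ge_0[of "f i $ l"] \<open>\<delta> \<le> 1\<close> by linarith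
    then show "cube (frac_vec (f i)) (\<delta> / 2) \<subseteq> cube (vec (1/2)) 1"
      unfolding cube_def infnorm_less_iff frac_vec_def by auto
  qed (use assms in auto)
  then show ?thesis by (simp add: measure_cube)
qed

section \<open>The scale \<open>q powr (- 1 / d)\<close>\<close>

lemma inv_root_pow:
  assumes "q \<ge> 1"
  shows "inv_root TYPE('n::finite) q ^ CARD('n) = 1 / real q"
  using assms unfolding inv_root_def
  by (subst powr_power) (auto simp: powr_minus_divide)

lemma inv_root_pos: "q \<ge> 1 \<Longrightarrow> 0 < inv_root TYPE('n::finite) q"
  by (simp add: inv_root_def)

lemma inv_root_antimono:
  "1 \<le> p \<Longrightarrow> p \<le> q \<Longrightarrow> inv_root TYPE('n::finite) q \<le> inv_root TYPE('n) p"
  unfolding inv_root_def by (intro powr_mono2') auto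

lemma inv_root_mult:
  "inv_root TYPE('n::finite) (p * q) = inv_root TYPE('n) p * inv_root TYPE('n) q"
  unfolding inv_root_def by (simp add: powr_mult)

text \<open>Holds since \<open>d \<ge> 1\<close>. It replaces the root of an integer factor by its
  plain inverse where only a constant is at stake.\<close>

lemma inv_root_ge_inverse:
  assumes "q \<ge> 1"
  shows "1 / real q \<le> inv_root TYPE('n::finite) q"
proof -
  have "real q powr (-1) \<le> real q powr (- (1 / real CARD('n)))"
    using assms by (intro powr_mono) auto
  then show ?thesis using assms by (simp add: inv_root_def powr_minus_divide)
qed

lemma inv_root_tendsto_0: "(\<lambda>q. inv_root TYPE('n::finite) q) \<longlonglongrightarrow> 0"
  unfolding inv_root_def
  by (intro tendsto_neg_powr filterlim_real_sequentially) auto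

text \<open>Multiplying by \<open>q\<close> turns the distance to \<open>p / q\<close> into the
  distance from \<open>q x\<close> to an integer vector and lowers the exponent from
  \<open>1 + 1 / d\<close> to \<open>1 / d\<close>.\<close>

lemma badly_approximable_iff:
  fixes x :: "real^'n"
  shows "badly_approximable x \<longleftrightarrow>
    (\<exists>\<epsilon>>0. \<forall>q\<ge>1. \<forall>p. \<epsilon> * inv_root TYPE('n) q \<le> infnorm (real q *\<^sub>R x - int_vec p))"
proof -
  have "\<epsilon> / real q powr (1 + 1 / real CARD('n)) \<le> infnorm (x - (\<chi> i. real_of_int (p $ i) / real q))
      \<longleftrightarrow> \<epsilon> * inv_root TYPE('n) q \<le> infnorm (real q *\<^sub>R x - int_vec p)"
    if "q \<ge> 1" for \<epsilon> and q :: nat and p :: "int^'n"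
  proof -
    have "real q *\<^sub>R x - int_vec p = real q *\<^sub>R (x - (\<chi> i. real_of_int (p $ i) / real q))"
      using that by (simp add: vec_eq_iff int_vec_def algebra_simps)
    then have *: "infnorm (real q *\<^sub>R x - int_vec p)
        = real q * infnorm (x - (\<chi> i. real_of_int (p $ i) / real q))"
      by (simp add: infnorm_mul)
    have **: "\<epsilon> / real q powr (1 + 1 / real CARD('n)) = \<epsilon> * inv_root TYPE('n) q / real q"
      using that by (simp add: inv_root_def powr_add powr_minus_divide)
    show ?thesis unfolding * ** using that by (simp add: pos_divide_le_eq mult.commute)
  qed
  then show ?thesis unfolding badly_approximable_def by blast
qed


section \<open>Covering by the orbit of a badly approximable point\<close>

text \<open>A fixed witness of bad approximability, capped at 1 so that the separations derived from
  it meet the hypothesis \<open>\<delta> \<le> 1\<close> of \<open>torus_packing\<close>.\<close>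

definition bad_approx_const :: "real^'n \<Rightarrow> real \<Rightarrow> bool" where
  "bad_approx_const x \<epsilon> \<longleftrightarrow> 0 < \<epsilon> \<and> \<epsilon> \<le> 1 \<and>
     (\<forall>q\<ge>1. \<forall>p. \<epsilon> * inv_root TYPE('n) q \<le> infnorm (real q *\<^sub>R x - int_vec p))"

lemma badly_approximable_imp_bad_approx_const:
  fixes x :: "real^'n"
  assumes "badly_approximable x"
  obtains \<epsilon> where "bad_approx_const x \<epsilon>"
proof -
  obtain \<epsilon> where \<epsilon>: "\<epsilon> > 0"
      "\<And>q p. q \<ge> 1 \<Longrightarrow> \<epsilon> * inv_root TYPE('n) q \<le> infnorm (real q *\<^sub>R x - int_vec p)"
    using assms unfolding badly_approximable_iff by blast
  have "min \<epsilon> 1 * inv_root TYPE('n) q \<le> infnorm (real q *\<^sub>R x - int_vec p)" if "q \<ge> 1" for q p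
  proof -
    have "min \<epsilon> 1 * inv_root TYPE('n) q \<le> \<epsilon> * inv_root TYPE('n) q"
      using inv_root_pos[OF that, where 'n = 'n] by (intro mult_right_mono) auto
    with \<epsilon>(2)[OF that, of p] show ?thesis by linarith
  qed
  then have "bad_approx_const x (min \<epsilon> 1)"
    using \<epsilon>(1) unfolding bad_approx_const_def by auto
  then show thesis by (rule that)
qed

text \<open>Monotonicity of \<open>inv_root\<close> yields one bound for all nonzero multipliers up
  to \<open>q\<close>. Negative \<open>k\<close> are included because \<open>k\<close> will be a
  difference of two orbit indices.\<close>

lemma bad_approx_const_int:
  fixes x :: "real^'n" and k :: int
  assumes "bad_approx_const x \<epsilon>" "k \<noteq> 0" "\<bar>k\<bar> \<le> int q"
  shows "\<epsilon> * inv_root TYPE('n) q \<le> infnorm (of_int k *\<^sub>R x - int_vec p)"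
proof -
  have k: "nat \<bar>k\<bar> \<ge> 1" "nat \<bar>k\<bar> \<le> q" using assms(2,3) by auto
  have *: "\<epsilon> * inv_root TYPE('n) q \<le> \<epsilon> * inv_root TYPE('n) (nat \<bar>k\<bar>)"
    using inv_root_antimono[OF k, where 'n = 'n] assms(1) by (simp add: bad_approx_const_def)
  have **: "\<epsilon> * inv_root TYPE('n) (nat \<bar>k\<bar>) \<le> infnorm (real (nat \<bar>k\<bar>) *\<^sub>R x - int_vec p')" for p'
    using assms(1) k(1) unfolding bad_approx_const_def by blast
  have "infnorm (of_int k *\<^sub>R x - int_vec p)
      = infnorm (real (nat \<bar>k\<bar>) *\<^sub>R x - int_vec (if k \<ge> 0 then p else - p))"
  proof (cases "k \<ge> 0")
    case True then show ?thesis by simp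
  next
    case False
    then have "real (nat \<bar>k\<bar>) *\<^sub>R x - int_vec (- p) = - (of_int k *\<^sub>R x - int_vec p)"
      by (simp add: int_vec_def vec_eq_iff)
    then have "infnorm (of_int k *\<^sub>R x - int_vec p)
        = infnorm (real (nat \<bar>k\<bar>) *\<^sub>R x - int_vec (- p))"
      by (simp only: infnorm_neg)
    then show ?thesis using False by simp
  qed
  then show ?thesis using * **[of "if k \<ge> 0 then p else - p"] by linarith
qed

text \<open>If \<open>y\<close> had no such approximation, the points \<open>n x + (i / F) y\<close>
  with \<open>n < M\<close> and \<open>i \<le> k\<close> would be separated modulo 1: for equal
  \<open>i\<close> by bad approximability of \<open>x\<close>, for different \<open>i\<close>
  because clearing the denominator would turn a close pair into a good approximation of
  \<open>y\<close>. These are too many points for \<open>torus_packing\<close>.\<close>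

lemma covering:
  fixes x :: "real^'n"
  assumes x: "bad_approx_const x \<epsilon>"
  obtains F :: nat where "F \<ge> 1"
    "\<And>M y. M \<ge> 1 \<Longrightarrow> \<exists>n p. \<bar>n\<bar> \<le> int (F * M) \<and>
       infnorm (y - of_int n *\<^sub>R x - int_vec p) < real F * \<epsilon> * inv_root TYPE('n) M"
proof -
  have \<epsilon>: "0 < \<epsilon>" "\<epsilon> \<le> 1" using x by (auto simp: bad_approx_const_def)
  \<comment> \<open>For \<open>M * (k + 1)\<close> points at separation \<open>\<delta>\<close>,
    where \<open>\<delta> ^ d = \<epsilon> ^ d / M\<close>, packing forces
    \<open>(k + 1) * \<epsilon> ^ d \<le> 2 ^ d\<close> whatever \<open>M\<close> is. This
    \<open>k\<close> violates it.\<close>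
  obtain k :: nat where k: "2 ^ CARD('n) / \<epsilon> ^ CARD('n) < real k"
    using reals_Archimedean2 by blast
  define F where "F = (fact k :: nat)"
  have F: "F \<ge> 1" by (simp add: F_def)
  moreover have "\<exists>n p. \<bar>n\<bar> \<le> int (F * M) \<and>
       infnorm (y - of_int n *\<^sub>R x - int_vec p) < real F * \<epsilon> * inv_root TYPE('n) M"
    if M: "M \<ge> 1" for M and y :: "real^'n"
  proof (rule ccontr)
    define \<delta> where "\<delta> = \<epsilon> * inv_root TYPE('n) M"
    assume "\<not> ?thesis"
    then have far: "real F * \<delta> \<le> infnorm (y - of_int n *\<^sub>R x - int_vec p)"
      if "\<bar>n\<bar> \<le> int (F * M)" for n p
      using that by (force simp: \<delta>_def not_less mult.assoc)
    have \<delta>: "0 < \<delta>" using \<epsilon> inv_root_pos[OF M, where 'n = 'n] by (simp add: \<delta>_def)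
    have "inv_root TYPE('n) M \<le> 1"
      using inv_root_antimono[of 1 M, where 'n = 'n] M by (simp add: inv_root_def)
    then have \<delta>1: "\<delta> \<le> 1"
      using \<epsilon> inv_root_pos[OF M, where 'n = 'n] unfolding \<delta>_def by (intro mult_le_one) auto
    define f where "f = (\<lambda>(n, i). real n *\<^sub>R x + (real i / real F) *\<^sub>R y)"
    have "real (card ({..<M} \<times> {..k})) * \<delta> ^ CARD('n) \<le> 2 ^ CARD('n)"
    proof (rule torus_packing[where f = f, OF _ \<delta> \<delta>1])
      fix a b p assume ab: "a \<in> {..<M} \<times> {..k}" "b \<in> {..<M} \<times> {..k}" "a \<noteq> b"
      obtain n i m j where eq: "a = (n, i)" "b = (m, j)" by fastforce
      define l where "l = int i - int j"
      define h where "h = int n - int m"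
      have h: "\<bar>h\<bar> \<le> int M" using ab by (auto simp: h_def eq)
      have fab: "f a - f b - int_vec p = of_int h *\<^sub>R x + (of_int l / real F) *\<^sub>R y - int_vec p"
        using F by (simp add: f_def eq h_def l_def algebra_simps diff_divide_distrib)
      show "\<delta> \<le> infnorm (f a - f b - int_vec p)"
      proof (cases "l = 0")
        case True
        then have "h \<noteq> 0" using ab by (auto simp: eq h_def l_def)
        then show ?thesis
          using bad_approx_const_int[OF x _ h, of p] True by (simp add: fab \<delta>_def)
      next
        case False
        text \<open>Multiplying by the complementary divisor of \<open>k!\<close> turns the difference into an
          approximation of \<open>y\<close> itself.\<close>
        have "\<bar>l\<bar> \<le> int k" using ab by (auto simp: eq l_def)
        then have "nat \<bar>l\<bar> dvd fact k" using False by (intro dvd_fact) auto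
        then have "l dvd int F" by (simp add: F_def int_dvd_int_iff[symmetric])
        then obtain g where g: "int F = l * g" by (auto simp: dvd_def)
        then have g0: "g \<noteq> 0" using F by auto
        have gF: "\<bar>g\<bar> \<le> int F"
        proof -
          have "g dvd int F" "int F \<noteq> 0" using F by (simp add: g, linarith)
          then show ?thesis using dvd_imp_le_int[of "int F" g] by simp
        qed
        have lg: "of_int g * (of_int l / real F) = 1"
        proof -
          have "real F = of_int l * of_int g" using g by (metis of_int_mult of_int_of_nat_eq)
          then show ?thesis using False g0 by simp
        qed
        have eq': "of_int g *\<^sub>R (f a - f b - int_vec p)
            = y - of_int (- (g * h)) *\<^sub>R x - int_vec (\<chi> i. g * p $ i)"
          unfolding fab scaleR_right_diff_distrib scaleR_right_distrib scaleR_scaleR lg int_vec_scale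
          by simp
        have "\<bar>- (g * h)\<bar> \<le> int (F * M)"
          using mult_mono[OF gF h] by (simp add: abs_mult)
        from far[OF this, of "\<chi> i. g * p $ i"]
        have "real F * \<delta> \<le> \<bar>of_int g\<bar> * infnorm (f a - f b - int_vec p)"
          by (simp only: eq'[symmetric] infnorm_mul)
        also have "\<dots> \<le> real F * infnorm (f a - f b - int_vec p)"
          using gF by (intro mult_right_mono infnorm_pos_le) linarith
        finally show ?thesis using F by simp
      qed
    qed auto
    moreover have "real (card ({..<M} \<times> {..k})) * \<delta> ^ CARD('n) = real (k + 1) * \<epsilon> ^ CARD('n)"
      using M by (simp add: \<delta>_def power_mult_distrib inv_root_pow card_cartesian_product field_simps)
    ultimately have "real (k + 1) \<le> 2 ^ CARD('n) / \<epsilon> ^ CARD('n)"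
      using \<epsilon> by (simp add: pos_le_divide_eq)
    with k show False by simp
  qed
  ultimately show thesis by (rule that)
qed

section \<open>Disjoint families of cubes\<close>

lemma sum_power_le:
  fixes a b :: real
  assumes "0 \<le> a" "0 \<le> b"
  shows "(a + b) ^ n \<le> 2 ^ n * (a ^ n + b ^ n)"
proof -
  have "(a + b) ^ n \<le> (2 * max a b) ^ n"
    using assms by (intro power_mono) auto
  also have "\<dots> = 2 ^ n * max a b ^ n" by (simp add: power_mult_distrib)
  also have "max a b ^ n \<le> a ^ n + b ^ n"
    using assms by (auto simp: max_def)
  finally show ?thesis by simp
qed

text \<open>As long as the accumulated volume \<open>w k\<close> is at most \<open>\<beta>\<close>,
  at most half of the cubes of level \<open>k\<close> meet earlier ones, so the union gains at least
  half of the volume of that level. Divergence eventually pushes \<open>w\<close> beyond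
  \<open>\<beta>\<close>, and by then the union has measure at least
  \<open>\<beta> / 2\<close>.\<close>

lemma greedy_union:
  fixes c :: "nat \<Rightarrow> real^'n" and J :: "nat \<Rightarrow> nat set" and \<rho> \<delta> :: "nat \<Rightarrow> real"
  defines "D \<equiv> CARD('n)"
  defines "W \<equiv> \<lambda>k. \<Union>j<k. \<Union>n\<in>J j. cube (c n) (\<rho> j)"
  assumes fin: "\<And>k. finite (J k)"
    and \<sigma>: "0 < \<sigma>" and \<delta>: "\<And>k. 0 < \<delta> k"
    and \<rho>0: "\<And>k. 0 \<le> \<rho> k" and \<rho>: "\<And>k. 2 * \<rho> k \<le> \<sigma> * \<delta> k"
    and sep: "\<And>k n m. n \<in> J k \<Longrightarrow> m \<in> J k \<Longrightarrow> n \<noteq> m \<Longrightarrow> \<sigma> * \<delta> k \<le> infnorm (c n - c m)"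
    and many: "\<And>k. \<alpha> \<le> real (card (J k)) * \<delta> k ^ D"
    and sparse: "\<And>k. 4 ^ D * (\<Sum>j<k. real (card (J j))) * \<delta> k ^ D \<le> \<alpha> / 4"
    and div: "\<not> summable (\<lambda>k. real (card (J k)) * (2 * \<rho> k) ^ D)"
  shows "\<exists>k. \<alpha> * (\<sigma> / 2) ^ D / 8 \<le> measure lebesgue (W k)"
proof -
  define w where "w = (\<lambda>k. \<Sum>j<k. real (card (J j)) * (2 * \<rho> j) ^ D)"
  \<comment> \<open>Chosen so that \<open>(2 / \<sigma>) ^ D * \<beta> = \<alpha> / 4\<close>.
    Together with the \<open>\<alpha> / 4\<close> from \<open>sparse\<close> this loses at most half
    of the lower bound in \<open>many\<close>.\<close>
  define \<beta> where "\<beta> = \<alpha> * (\<sigma> / 2) ^ D / 4"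
  have W_meas: "W k \<in> lmeasurable" for k
    unfolding W_def using fin by (intro fmeasurable.finite_UN) auto
  have step: "measure lebesgue (W k) + real (card (J k)) * (2 * \<rho> k) ^ D / 2
      \<le> measure lebesgue (W (Suc k))" if wk: "w k \<le> \<beta>" for k
  proof -
    define near where "near = (\<lambda>j m. {n \<in> J k. infnorm (c n - c m) < \<rho> k + \<rho> j})"
    define Bad where "Bad = {n \<in> J k. cube (c n) (\<rho> k) \<inter> W k \<noteq> {}}"
    \<comment> \<open>The disjoint cubes of radius \<open>\<sigma> * \<delta> k / 2\<close> about
      the near centres fit into a slightly enlarged earlier cube. The bound splits into a term per
      earlier cube, summed by \<open>sparse\<close>, and a term proportional to its volume, summed
      by \<open>w k\<close>.\<close>
    have near: "real (card (near j m)) * \<delta> k ^ D \<le> 4 ^ D * \<delta> k ^ D + (2 / \<sigma>) ^ D * (2 * \<rho> j) ^ D"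
      for j m
    proof -
      have "real (card (near j m)) * (\<sigma> * \<delta> k) ^ D
          \<le> measure lebesgue (cube (c m) (\<rho> j + \<sigma> * \<delta> k))"
        unfolding D_def
      proof (rule packing[where f = c])
        fix n assume "n \<in> near j m"
        then show "cube (c n) (\<sigma> * \<delta> k / 2) \<subseteq> cube (c m) (\<rho> j + \<sigma> * \<delta> k)"
          using \<rho>[of k] by (intro cube_subset) (auto simp: near_def)
      qed (use fin sep \<sigma> \<delta> in \<open>auto simp: near_def\<close>)
      also have "\<dots> = (2 * \<rho> j + 2 * \<sigma> * \<delta> k) ^ D"
        using \<rho>0[of j] \<sigma> \<delta>[of k] by (simp add: measure_cube D_def algebra_simps)
      also have "\<dots> \<le> 2 ^ D * ((2 * \<rho> j) ^ D + (2 * \<sigma> * \<delta> k) ^ D)"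
        using \<rho>0[of j] \<sigma> \<delta>[of k] by (intro sum_power_le) auto
      also have "\<dots> = (4 ^ D * \<delta> k ^ D + (2 / \<sigma>) ^ D * (2 * \<rho> j) ^ D) * \<sigma> ^ D"
      proof -
        have "(2::real) ^ D * 2 ^ D = 4 ^ D" by (simp flip: power_mult_distrib)
        then show ?thesis
          using \<sigma> by (simp add: power_mult_distrib power_divide field_simps)
      qed
      finally have "(real (card (near j m)) * \<delta> k ^ D) * \<sigma> ^ D
          \<le> (4 ^ D * \<delta> k ^ D + (2 / \<sigma>) ^ D * (2 * \<rho> j) ^ D) * \<sigma> ^ D"
        by (simp add: power_mult_distrib ac_simps)
      then show ?thesis using \<sigma> by (simp only: mult_le_cancel_right_pos zero_less_power)
    qed
    have Bad_sub: "Bad \<subseteq> (\<Union>j<k. \<Union>m\<in>J j. near j m)"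
    proof
      fix n assume "n \<in> Bad"
      then obtain j m where "n \<in> J k" "j < k" "m \<in> J j" "cube (c n) (\<rho> k) \<inter> cube (c m) (\<rho> j) \<noteq> {}"
        by (auto simp: Bad_def W_def)
      then show "n \<in> (\<Union>j<k. \<Union>m\<in>J j. near j m)"
        using cube_Int_imp by (fastforce simp: near_def)
    qed
    have "card Bad \<le> card (\<Union>j<k. \<Union>m\<in>J j. near j m)"
      using Bad_sub fin by (intro card_mono) (auto simp: near_def)
    also have "\<dots> \<le> (\<Sum>j<k. card (\<Union>m\<in>J j. near j m))" by (rule card_UN_le) simp
    also have "\<dots> \<le> (\<Sum>j<k. \<Sum>m\<in>J j. card (near j m))"
      by (intro sum_mono card_UN_le fin)
    finally have "real (card Bad) \<le> (\<Sum>j<k. \<Sum>m\<in>J j. real (card (near j m)))"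
      by (simp flip: of_nat_sum)
    then have "real (card Bad) * \<delta> k ^ D \<le> (\<Sum>j<k. \<Sum>m\<in>J j. real (card (near j m)) * \<delta> k ^ D)"
      using \<delta>[of k] by (simp add: mult_right_mono flip: sum_distrib_right)
    also have "\<dots> \<le> (\<Sum>j<k. \<Sum>m\<in>J j. 4 ^ D * \<delta> k ^ D + (2 / \<sigma>) ^ D * (2 * \<rho> j) ^ D)"
      by (intro sum_mono near)
    also have "\<dots> = 4 ^ D * (\<Sum>j<k. real (card (J j))) * \<delta> k ^ D + (2 / \<sigma>) ^ D * w k"
      by (simp add: w_def sum.distrib sum_distrib_left sum_distrib_right algebra_simps)
    also have "\<dots> \<le> \<alpha> / 4 + (2 / \<sigma>) ^ D * \<beta>"
      using sparse[of k] wk \<sigma> by (intro add_mono mult_left_mono) auto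
    also have "\<dots> = \<alpha> / 2"
      using \<sigma> by (simp add: \<beta>_def power_divide)
    also have "\<dots> \<le> real (card (J k)) / 2 * \<delta> k ^ D" using many[of k] by simp
    finally have Bad: "real (card Bad) \<le> real (card (J k)) / 2"
      using \<delta>[of k] by (simp only: mult_le_cancel_right_pos zero_less_power)
    define Good where "Good = J k - Bad"
    have "Bad \<subseteq> J k" by (auto simp: Bad_def)
    then have "card Good + card Bad = card (J k)"
      unfolding Good_def using fin[of k] by (metis card_Diff_subset card_mono finite_subset le_add_diff_inverse2)
    then have Good: "real (card (J k)) / 2 \<le> real (card Good)" using Bad by linarith
    define V where "V = (\<Union>n\<in>Good. cube (c n) (\<rho> k))"
    have V_meas: "V \<in> lmeasurable"
      unfolding V_def Good_def using fin by (intro fmeasurable.finite_UN) auto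
    have "measure lebesgue V = real (card Good) * (2 * \<rho> k) ^ D"
      unfolding V_def D_def
    proof (rule measure_disjoint_cubes)
      fix i j assume "i \<in> Good" "j \<in> Good" "i \<noteq> j"
      then show "2 * \<rho> k \<le> infnorm (c i - c j)"
        using sep[of i k j] \<rho>[of k] by (auto simp: Good_def)
    qed (use fin \<rho>0 in \<open>auto simp: Good_def\<close>)
    moreover have "real (card (J k)) / 2 * (2 * \<rho> k) ^ D \<le> real (card Good) * (2 * \<rho> k) ^ D"
      using Good \<rho>0[of k] by (intro mult_right_mono) auto
    moreover have "W k \<inter> V = {}" by (auto simp: V_def Good_def Bad_def)
    then have "measure lebesgue (W k \<union> V) = measure lebesgue (W k) + measure lebesgue V"
      using W_meas V_meas by (intro measure_Un2[THEN trans]) (auto simp: Diff_triv Int_commute)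
    moreover have "measure lebesgue (W k \<union> V) \<le> measure lebesgue (W (Suc k))"
    proof (rule measure_mono_fmeasurable)
      show "W k \<union> V \<subseteq> W (Suc k)"
        by (auto simp: W_def V_def Good_def less_Suc_eq)
    qed (use W_meas V_meas in auto)
    ultimately show ?thesis by linarith
  qed
  have half: "(\<forall>j<k. w j \<le> \<beta>) \<Longrightarrow> w k / 2 \<le> measure lebesgue (W k)" for k
  proof (induction k)
    case 0 then show ?case by (simp add: w_def)
  next
    case (Suc k)
    then show ?case using step[of k] by (simp add: w_def)
  qed
  have "\<exists>k. \<beta> < w k"
  proof (rule ccontr)
    assume "\<not> ?thesis"
    then have "summable (\<lambda>k. real (card (J k)) * (2 * \<rho> k) ^ D)"
      using \<rho>0 by (intro summableI_nonneg_bounded[where x = \<beta>]) (auto simp: w_def not_less)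
    with div show False by simp
  qed
  \<comment> \<open>The first index with \<open>w k\<close> above \<open>\<beta>\<close>. Since
    \<open>half\<close> needs the bound only strictly before \<open>k\<close>, the overshoot at the
    last level does no harm.\<close>
  then obtain k where "\<beta> < w k" "\<forall>j<k. w j \<le> \<beta>"
    using exists_least_iff[of "\<lambda>k. \<beta> < w k"] by (auto simp: not_less)
  with half[of k] show ?thesis by (auto intro!: exI[of _ k] simp: \<beta>_def)
qed

section \<open>Badly approximable points\<close>

text \<open>Triangle inequality on the expansion in the standard basis.\<close>

lemma norm_le_infnorm_bound:
  fixes N :: "real^'n \<Rightarrow> real"
  assumes "is_norm N"
  obtains b where "b > 0" "\<And>v. N v \<le> b * infnorm v"
proof -
  have N: "\<And>v. 0 \<le> N v" "\<And>c v. N (c *\<^sub>R v) = \<bar>c\<bar> * N v" "\<And>u v. N (u + v) \<le> N u + N v" "N 0 = 0"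
    using assms by (auto simp: is_norm_def)
  define b where "b = (\<Sum>i\<in>UNIV. N (axis i 1)) + 1"
  have sum_le: "N (\<Sum>i\<in>A. g i) \<le> (\<Sum>i\<in>A. N (g i))" if "finite A" for A and g :: "'n \<Rightarrow> real^'n"
    using that
  proof induction
    case (insert i A)
    then show ?case using N(3)[of "g i" "sum g A"] by simp
  qed (simp add: N)
  have "N v \<le> b * infnorm v" for v
  proof -
    have "N v = N (\<Sum>i\<in>UNIV. v $ i *\<^sub>R axis i 1)"
      by (simp add: basis_expansion flip: scalar_mult_eq_scaleR)
    also have "\<dots> \<le> (\<Sum>i\<in>UNIV. N (v $ i *\<^sub>R axis i 1))" by (rule sum_le) simp
    also have "\<dots> \<le> (\<Sum>i\<in>UNIV. infnorm v * N (axis i 1))"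
      by (intro sum_mono) (simp add: N mult_right_mono component_le_infnorm_cart)
    also have "\<dots> \<le> b * infnorm v"
      by (simp add: b_def algebra_simps infnorm_pos_le flip: sum_distrib_left)
    finally show ?thesis .
  qed
  moreover have "b > 0" using N(1) by (simp add: b_def sum_nonneg add_nonneg_pos)
  ultimately show thesis by (rule that[rotated])
qed

text \<open>The reverse triangle inequality and the bound by \<open>infnorm\<close> make
  \<open>N\<close> Lipschitz.\<close>

lemma continuous_on_is_norm:
  fixes N :: "real^'n \<Rightarrow> real"
  assumes "is_norm N"
  shows "continuous_on S N"
proof -
  obtain b where b: "b > 0" "\<And>v. N v \<le> b * infnorm v"
    using norm_le_infnorm_bound[OF assms] by blast
  have tri: "N u \<le> N v + N (u - v)" for u v
    using assms unfolding is_norm_def by (metis add.commute diff_add_cancel)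
  have "N u - N v \<le> b * norm (u - v)" for u v
    using tri[of u v] b(2)[of "u - v"] mult_left_mono[OF infnorm_le_norm[of "u - v"], of b] b(1)
    by linarith
  then have "\<bar>N u - N v\<bar> \<le> b * norm (u - v)" for u v
    by (smt (verit) norm_minus_commute)
  then have "b-lipschitz_on S N"
    using b(1) by (intro lipschitz_onI) (auto simp: dist_norm)
  then show ?thesis by (rule lipschitz_on_continuous_on)
qed

section \<open>Radius sequences and condensation\<close>

lemma P_seq_antimono:
  assumes "P_seq d r" "1 \<le> m" "m \<le> n"
  shows "r n \<le> r m"
  using assms(3,2)
proof (induction rule: dec_induct)
  case (step n)
  then have "r (Suc n) \<le> r n" using assms(1) by (simp add: P_seq_def)
  with step show ?case by simp
qed simp

lemma P_seq_nonneg: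
  assumes "P_seq d r" "1 \<le> n"
  shows "0 \<le> r n"
proof (rule LIMSEQ_le_const2)
  show "r \<longlonglongrightarrow> 0" using assms(1) by (simp add: P_seq_def)
  show "\<exists>k. \<forall>j\<ge>k. r j \<le> r n" using P_seq_antimono[OF assms] by blast
qed

text \<open>Cauchy condensation with ratio \<open>B\<close> and offset \<open>A\<close>: the block
  from \<open>A * B ^ k\<close> up to \<open>A * B ^ Suc k\<close> has at most
  \<open>A * B ^ Suc k\<close> terms, none above its first.\<close>

lemma condensation:
  fixes g :: "nat \<Rightarrow> real"
  assumes mono: "\<And>m n. 1 \<le> m \<Longrightarrow> m \<le> n \<Longrightarrow> g n \<le> g m" and nonneg: "\<And>n. 1 \<le> n \<Longrightarrow> 0 \<le> g n"
    and "A \<ge> 1" "B \<ge> 2" and sum: "summable (\<lambda>k. real (B ^ k) * g (A * B ^ k))"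
  shows "summable g"
proof -
  define h where "h = (\<lambda>k. real (B ^ k) * g (A * B ^ k))"
  have AB: "1 \<le> A * B ^ k" for k using assms(3,4) by simp
  have h0: "0 \<le> h k" for k using nonneg[OF AB] by (simp add: h_def)
  have part: "sum g {A..<A * B ^ k} \<le> real (A * B) * (\<Sum>j<k. h j)" for k
  proof (induction k)
    case (Suc k)
    have le: "A * B ^ k \<le> A * B ^ Suc k" using assms(4) by simp
    have "sum g {A * B ^ k..<A * B ^ Suc k} \<le> (\<Sum>i\<in>{A * B ^ k..<A * B ^ Suc k}. g (A * B ^ k))"
      using AB by (intro sum_mono mono) auto
    also have "\<dots> \<le> real (A * B ^ Suc k) * g (A * B ^ k)"
      using nonneg[OF AB[of k]] by (simp add: mult_right_mono del: of_nat_mult of_nat_power)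
    also have "\<dots> = real (A * B) * h k" by (simp add: h_def)
    finally have *: "sum g {A * B ^ k..<A * B ^ Suc k} \<le> real (A * B) * h k" .
    have "sum g {A..<A * B ^ Suc k} = sum g {A..<A * B ^ k} + sum g {A * B ^ k..<A * B ^ Suc k}"
      using assms(3,4) le by (intro sum.atLeastLessThan_concat[symmetric]) auto
    with Suc * show ?case by (simp add: algebra_simps)
  qed simp
  have "summable (\<lambda>n. g (n + A))"
  proof (rule summableI_nonneg_bounded)
    fix n
    show "0 \<le> g (n + A)" using assms(3) by (intro nonneg) simp
    have "Suc n \<le> B ^ n"
      using assms(4) less_exp[of n] power_mono[of 2 B n] by linarith
    then have "A * Suc n \<le> A * B ^ n" by (rule mult_le_mono2)
    then have "n + A \<le> A * B ^ n"
      using assms(3) by (cases A) (auto simp: algebra_simps intro: order_trans[rotated])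
    have "(\<Sum>i<n. g (i + A)) = sum g {A..<n + A}"
      using sum.shift_bounds_nat_ivl[of g 0 A n] by (simp add: lessThan_atLeast0)
    also have "\<dots> \<le> sum g {A..<A * B ^ n}"
      using \<open>n + A \<le> A * B ^ n\<close> assms(3) by (intro sum_mono2 nonneg) auto
    also have "\<dots> \<le> real (A * B) * (\<Sum>j<n. h j)" by (rule part)
    also have "\<dots> \<le> real (A * B) * suminf h"
      using sum h0 by (intro mult_left_mono sum_le_suminf) (auto simp: h_def)
    finally show "(\<Sum>i<n. g (i + A)) \<le> real (A * B) * suminf h" .
  qed
  then show ?thesis by (simp add: summable_iff_shift)
qed

text \<open>Applying \<open>covering\<close> to \<open>y - 2 F M x\<close> shifts the symmetric
  index range to positive indices, which also tend to infinity with \<open>M\<close>.\<close>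

lemma covering_block:
  fixes x :: "real^'n"
  assumes x: "bad_approx_const x \<epsilon>"
  obtains F :: nat where "F \<ge> 1"
    "\<And>M y. M \<ge> 1 \<Longrightarrow> \<exists>n\<in>{F * M..3 * F * M}. \<exists>p.
       infnorm (y - real n *\<^sub>R x - int_vec p) < real F * \<epsilon> * inv_root TYPE('n) M"
proof -
  obtain F :: nat where F: "F \<ge> 1"
    and cov: "\<And>M y. M \<ge> 1 \<Longrightarrow> \<exists>n p. \<bar>n\<bar> \<le> int (F * M) \<and>
       infnorm (y - of_int n *\<^sub>R x - int_vec p) < real F * \<epsilon> * inv_root TYPE('n) M"
    using covering[OF x] by metis
  have "\<exists>n\<in>{F * M..3 * F * M}. \<exists>p.
       infnorm (y - real n *\<^sub>R x - int_vec p) < real F * \<epsilon> * inv_root TYPE('n) M"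
    if M: "M \<ge> 1" for M y
  proof -
    obtain n p where n: "\<bar>n\<bar> \<le> int (F * M)"
      and p: "infnorm (y - real (2 * F * M) *\<^sub>R x - of_int n *\<^sub>R x - int_vec p)
        < real F * \<epsilon> * inv_root TYPE('n) M"
      using cov[OF M, of "y - real (2 * F * M) *\<^sub>R x"] by blast
    define n' where "n' = nat (n + int (2 * F * M))"
    have n': "int n' = n + int (2 * F * M)" using n by (simp add: n'_def)
    have "int (F * M) \<le> int n'" "int n' \<le> int (3 * F * M)" using n n' by auto
    then have "n' \<in> {F * M..3 * F * M}" by (simp only: of_nat_le_iff atLeastAtMost_iff)
    moreover have "real n' = of_int n + real (2 * F * M)"
      using n' by (metis of_int_add of_int_of_nat_eq)
    then have "y - real n' *\<^sub>R x = y - real (2 * F * M) *\<^sub>R x - of_int n *\<^sub>R x"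
      by (simp only: scaleR_add_left) simp
    ultimately show ?thesis using p by (intro bexI[of _ n'] exI[of _ p]) (simp only:)
  qed
  with F show thesis by (rule that)
qed

text \<open>Indices of one block differ by at most \<open>2 * F * M\<close>, and the integer parts
  are absorbed into the integer vector.\<close>

lemma separation_block:
  fixes x :: "real^'n"
  assumes x: "bad_approx_const x \<epsilon>" and FM: "F \<ge> 1" "M \<ge> 1"
    and nm: "n \<in> {F * M..3 * F * M}" "m \<in> {F * M..3 * F * M}" "n \<noteq> m"
  shows "\<epsilon> / (2 * real F) * inv_root TYPE('n) M
    \<le> infnorm (frac_vec (real n *\<^sub>R x) - frac_vec (real m *\<^sub>R x))"
proof -
  obtain p q where pq: "frac_vec (real n *\<^sub>R x) = real n *\<^sub>R x - int_vec p"
      "frac_vec (real m *\<^sub>R x) = real m *\<^sub>R x - int_vec q"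
    by (metis frac_vec_obtain)
  have "\<epsilon> / (2 * real F) * inv_root TYPE('n) M = \<epsilon> * (1 / real (2 * F)) * inv_root TYPE('n) M"
    by simp
  also have "\<dots> \<le> \<epsilon> * inv_root TYPE('n) (2 * F) * inv_root TYPE('n) M"
    using x inv_root_ge_inverse[of "2 * F", where 'n = 'n] FM inv_root_pos[of M, where 'n = 'n]
    by (intro mult_right_mono mult_left_mono) (auto simp: bad_approx_const_def)
  also have "\<dots> = \<epsilon> * inv_root TYPE('n) (2 * F * M)"
    by (simp add: inv_root_mult)
  also have "\<dots> \<le> infnorm (of_int (int n - int m) *\<^sub>R x - int_vec (p - q))"
  proof (rule bad_approx_const_int[OF x])
    have "int (F * M) \<le> int n" "int n \<le> int (3 * F * M)" "int (F * M) \<le> int m" "int m \<le> int (3 * F * M)"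
      using nm by (simp_all only: of_nat_le_iff atLeastAtMost_iff)
    then show "\<bar>int n - int m\<bar> \<le> int (2 * F * M)" by auto
  qed (use nm in auto)
  also have "of_int (int n - int m) *\<^sub>R x - int_vec (p - q)
      = frac_vec (real n *\<^sub>R x) - frac_vec (real m *\<^sub>R x)"
    unfolding pq by (simp add: int_vec_diff scaleR_diff_left)
  finally show ?thesis .
qed

lemma compact_cube_margin:
  fixes K :: "(real^'n) set"
  assumes "compact K" "open S" "K \<subseteq> S"
  obtains t where "t > 0" "\<And>y. y \<in> K \<Longrightarrow> cube y t \<subseteq> S"
proof -
  obtain d where d: "d > 0" "\<And>y z. y \<in> K \<Longrightarrow> z \<in> - S \<Longrightarrow> d \<le> dist y z"
    using separate_compact_closed[of K "- S"] assms by (metis Compl_disjoint closed_Compl disjoint_eq_subset_Compl double_compl)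
  \<comment> \<open>The factor \<open>1 / d\<close> accounts for bounding the Euclidean norm by the
    sum of the coordinates.\<close>
  define t where "t = d / real CARD('n)"
  have "cube y t \<subseteq> S" if "y \<in> K" for y
  proof (rule subsetI, rule ccontr)
    fix z assume z: "z \<in> cube y t" "z \<notin> S"
    have "norm (z - y) \<le> (\<Sum>i\<in>UNIV. \<bar>(z - y) $ i\<bar>)" by (rule norm_le_l1_cart)
    also have "\<dots> < (\<Sum>i\<in>(UNIV :: 'n set). t)"
      using z(1) by (intro sum_strict_mono) (auto simp: cube_def infnorm_less_iff)
    also have "\<dots> = d" by (simp add: t_def)
    finally show False using d(2)[OF that, of z] z(2) by (simp add: dist_norm norm_minus_commute)
  qed
  moreover have "t > 0" using d(1) by (simp add: t_def)
  ultimately show thesis by (rule that[rotated])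
qed

text \<open>Truncation at \<open>s * \<delta> k\<close> preserves divergence. Were the sum finite,
  \<open>M k * ?\<rho> k ^ D\<close> would tend to 0, whereas it equals \<open>s ^ D\<close>
  whenever the truncation is active. So eventually the radii are the untruncated ones, and
  \<open>condensation\<close> contradicts \<open>P_seq\<close>.\<close>

lemma not_summable_block_radii:
  fixes r :: "nat \<Rightarrow> real"
  assumes r: "P_seq D r" and AB: "A \<ge> 1" "B \<ge> 2" and "b > 0" "s > 0"
    and \<delta>: "\<And>k. 0 < \<delta> k" "\<And>k. real (B ^ (k0 + k)) * \<delta> k ^ D = 1"
    and "\<alpha> > 0" and many: "\<And>k. \<alpha> \<le> real (a k) * \<delta> k ^ D"
  shows "\<not> summable (\<lambda>k. real (a k) * (2 * min (r (A * B ^ (k0 + k)) / b) (s * \<delta> k)) ^ D)"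
    (is "\<not> summable (\<lambda>k. real (a k) * (2 * ?\<rho> k) ^ D)")
proof
  define M where "M = (\<lambda>k. real (B ^ (k0 + k)))"
  assume sum: "summable (\<lambda>k. real (a k) * (2 * ?\<rho> k) ^ D)"
  have M0: "0 < M k" for k using AB by (simp add: M_def)
  have A1: "1 \<le> A * B ^ k" for k using AB by simp
  have \<rho>0: "0 \<le> ?\<rho> k" for k
    using P_seq_nonneg[OF r A1] \<open>b > 0\<close> \<open>s > 0\<close> \<delta>(1)[of k] by simp
  have aM: "\<alpha> * M k \<le> real (a k)" for k
  proof -
    have "\<alpha> * M k \<le> real (a k) * \<delta> k ^ D * M k"
      using many[of k] M0[of k] by (intro mult_right_mono) auto
    also have "\<dots> = real (a k)" using \<delta>(2)[of k] by (simp add: M_def ac_simps)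
    finally show ?thesis .
  qed
  have "summable (\<lambda>k. M k * ?\<rho> k ^ D * (\<alpha> * 2 ^ D))"
  proof (rule summable_comparison_test'[OF sum, of 0])
    fix k :: nat
    have "M k * ?\<rho> k ^ D * (\<alpha> * 2 ^ D) = (\<alpha> * M k) * (2 * ?\<rho> k) ^ D"
      by (simp only: power_mult_distrib) (simp only: ac_simps)
    also have "\<dots> \<le> real (a k) * (2 * ?\<rho> k) ^ D"
      using \<rho>0[of k] by (intro mult_right_mono aM) simp
    finally have "M k * ?\<rho> k ^ D * (\<alpha> * 2 ^ D) \<le> real (a k) * (2 * ?\<rho> k) ^ D" .
    moreover have "0 \<le> M k * ?\<rho> k ^ D * (\<alpha> * 2 ^ D)"
      using \<rho>0[of k] M0[of k] \<open>\<alpha> > 0\<close> by (intro mult_nonneg_nonneg zero_le_power) auto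
    ultimately show "norm (M k * ?\<rho> k ^ D * (\<alpha> * 2 ^ D)) \<le> real (a k) * (2 * ?\<rho> k) ^ D"
      by (simp only: real_norm_def abs_of_nonneg)
  qed
  then have sumM: "summable (\<lambda>k. M k * ?\<rho> k ^ D)"
    using \<open>\<alpha> > 0\<close> summable_mult2[of "\<lambda>k. M k * ?\<rho> k ^ D * (\<alpha> * 2 ^ D)" "1 / (\<alpha> * 2 ^ D)"]
    by simp
  have "\<forall>\<^sub>F k in sequentially. M k * ?\<rho> k ^ D < s ^ D"
    using summable_LIMSEQ_zero[OF sumM] \<open>s > 0\<close> by (intro order_tendstoD) auto
  then have ev: "\<forall>\<^sub>F k in sequentially. M k * ?\<rho> k ^ D = M k * r (A * B ^ (k0 + k)) ^ D / b ^ D"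
  proof eventually_elim
    case (elim k)
    have "?\<rho> k \<noteq> s * \<delta> k"
    proof
      assume eq: "?\<rho> k = s * \<delta> k"
      have "M k * (s * \<delta> k) ^ D = s ^ D"
        using \<delta>(2)[of k] by (simp add: power_mult_distrib M_def ac_simps)
      with elim eq show False by simp
    qed
    then have "?\<rho> k = r (A * B ^ (k0 + k)) / b" by (simp add: min_def split: if_splits)
    then show ?case by (simp only: power_divide times_divide_eq_right)
  qed
  have "summable (\<lambda>k. M k * r (A * B ^ (k0 + k)) ^ D / b ^ D)"
    using sumM summable_cong[OF ev] by simp
  then have "summable (\<lambda>k. M k * r (A * B ^ (k0 + k)) ^ D)"
    using \<open>b > 0\<close> by (subst (asm) summable_divide_iff) auto
  then have "summable (\<lambda>k. real (B ^ (k + k0)) * r (A * B ^ (k + k0)) ^ D)"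
    by (simp add: M_def add.commute)
  then have "summable (\<lambda>k. real (B ^ k) * r (A * B ^ k) ^ D)"
    by (rule summable_iff_shift[THEN iffD1])
  then have "summable (\<lambda>n. r n ^ D)"
    using P_seq_antimono[OF r] P_seq_nonneg[OF r] AB
    by (intro condensation[where A = A and B = B and g = "\<lambda>n. r n ^ D"] power_mono) auto
  then have "summable (\<lambda>n. r (Suc n) ^ D)"
    using summable_Suc_iff[of "\<lambda>n. r n ^ D"] by simp
  with r show False by (simp add: P_seq_def)
qed

lemma open_unit_cube: "open {y :: real^'n. \<forall>i. 0 < y $ i \<and> y $ i < 1}"
  and bounded_unit_cube: "bounded {y :: real^'n. \<forall>i. 0 < y $ i \<and> y $ i < 1}"
proof -
  have "{y :: real^'n. \<forall>i. 0 < y $ i \<and> y $ i < 1} = box 0 1"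
    by (auto simp: mem_box_cart)
  then show "open {y :: real^'n. \<forall>i. 0 < y $ i \<and> y $ i < 1}"
    "bounded {y :: real^'n. \<forall>i. 0 < y $ i \<and> y $ i < 1}"
    by (simp_all add: open_box)
qed

text \<open>The decisive point is that the proportion \<open>c2\<close> of an open set that the
  cubes cover does not depend on that set, so it can be fixed before enclosing \<open>V\<close>
  tightly.\<close>

lemma negligible_avoiding_set:
  fixes N :: "real^'n \<Rightarrow> real" and x :: "real^'n" and m :: nat
  assumes N: "is_norm N" and x: "bad_approx_const x \<epsilon>" and r: "P_seq CARD('n) r"
  defines "U \<equiv> {y :: real^'n. \<forall>i. 0 < y $ i \<and> y $ i < 1}"
  defines "V \<equiv> {y \<in> U. \<forall>n\<ge>m. r n \<le> N (y - frac_vec (real n *\<^sub>R x))}"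
  shows "negligible V"
proof (rule ccontr)
  define D where "D = CARD('n)"
  define c where "c = (\<lambda>n. frac_vec (real n *\<^sub>R x))"
  obtain b where b: "b > 0" "\<And>v. N v \<le> b * infnorm v"
    using norm_le_infnorm_bound[OF N] by blast
  obtain F :: nat where F: "F \<ge> 1" and cover: "\<And>M y. M \<ge> 1 \<Longrightarrow> \<exists>n\<in>{F * M..3 * F * M}. \<exists>p.
       infnorm (y - real n *\<^sub>R x - int_vec p) < real F * \<epsilon> * inv_root TYPE('n) M"
    using covering_block[OF x] by metis
  have \<epsilon>: "0 < \<epsilon>" using x by (simp add: bad_approx_const_def)
  define C where "C = real F * \<epsilon>"
  define \<sigma> where "\<sigma> = \<epsilon> / (2 * real F)"
  have C: "C > 0" and \<sigma>: "\<sigma> > 0" using F \<epsilon> by (auto simp: C_def \<sigma>_def)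
  have \<sigma>C: "\<sigma> \<le> C"
  proof -
    have "\<epsilon> / (2 * real F) \<le> \<epsilon> / 1" using F \<epsilon> by (intro divide_left_mono) auto
    also have "\<dots> \<le> real F * \<epsilon>" using F \<epsilon> by simp
    finally show ?thesis by (simp add: C_def \<sigma>_def)
  qed
  \<comment> \<open>Cubes of radius \<open>C * \<delta> k\<close> covering half of the measure of
    \<open>S\<close> must number at least \<open>c1 * \<mu> / \<delta> k ^ D\<close>. The next
    constant is what \<open>greedy_union\<close> then returns, divided by
    \<open>\<mu>\<close>.\<close>
  define c1 where "c1 = 1 / (2 * (2 * C) ^ D)"
  define c2 where "c2 = c1 * (\<sigma> / 2) ^ D / 8"
  have c1: "c1 > 0" and c2: "c2 > 0" using C \<sigma> by (auto simp: c1_def c2_def)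

  have U: "open U" "bounded U"
    unfolding U_def by (rule open_unit_cube bounded_unit_cube)+
  have "V = U \<inter> (\<Inter>n\<in>{m..}. {y. r n \<le> N (y - c n)})"
    by (auto simp: V_def c_def)
  moreover have "closed {y. r n \<le> N (y - c n)}" for n
    by (intro closed_Collect_le continuous_intros
        continuous_on_compose2[OF continuous_on_is_norm[OF N, of UNIV]]) auto
  ultimately have "V \<in> sets lebesgue"
    using U by (auto intro!: sets.Int closed_INT simp: borel_open borel_closed)
  moreover have "bounded V" using U(2) by (rule bounded_subset) (auto simp: V_def)
  ultimately have V: "V \<in> lmeasurable" using bounded_set_imp_lmeasurable by blast
  assume "\<not> negligible V"
  then have v: "measure lebesgue V > 0"
    using V by (simp add: negligible_iff_measure zero_less_measure_iff)
  obtain T where T: "open T" "V \<subseteq> T" "T - V \<in> lmeasurable"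
      "emeasure lebesgue (T - V) < ennreal (c2 * measure lebesgue V)"
    using sets_lebesgue_outer_open[of V "c2 * measure lebesgue V"] V v c2 by (auto simp: fmeasurableD)
  have TV: "measure lebesgue (T - V) < c2 * measure lebesgue V"
    using T(3,4) c2 v by (simp add: emeasure_eq_measure2 ennreal_less_iff)
  \<comment> \<open>Intersecting with the unit cube ensures that translates landing in
    \<open>S\<close> are genuine fractional parts.\<close>
  define S where "S = T \<inter> U"
  have S: "open S" "bounded S" using T U by (auto simp: S_def intro: bounded_subset)
  then have Sm: "S \<in> lmeasurable" by (intro bounded_set_imp_lmeasurable) (auto simp: borel_open)
  define \<mu> where "\<mu> = measure lebesgue S"
  have "measure lebesgue V \<le> \<mu>"
    unfolding \<mu>_def using T(2) by (intro measure_mono_fmeasurable fmeasurableD V Sm) (auto simp: S_def V_def)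
  then have \<mu>: "\<mu> > 0" and TV\<mu>: "measure lebesgue (T - V) < c2 * \<mu>"
    using v TV mult_left_mono[of "measure lebesgue V" \<mu> c2] c2 by linarith+
  obtain K where K: "closed K" "K \<subseteq> S" "S - K \<in> lmeasurable" "emeasure lebesgue (S - K) < ennreal (\<mu> / 2)"
    using sets_lebesgue_inner_closed[of S "\<mu> / 2"] Sm \<mu> by (auto simp: fmeasurableD)
  have "compact K" using K S by (meson bounded_subset compact_eq_bounded_closed)
  then have Km: "K \<in> lmeasurable" by (rule lmeasurable_compact)
  have "measure lebesgue (S - K) < \<mu> / 2"
    using K(3,4) \<mu> by (simp add: emeasure_eq_measure2 ennreal_less_iff)
  moreover have "measure lebesgue (S - K) = \<mu> - measure lebesgue K"
    unfolding \<mu>_def using Sm Km K(2) by (intro measurable_measure_Diff) (auto simp: fmeasurableD)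
  ultimately have K\<mu>: "\<mu> / 2 \<le> measure lebesgue K" by simp
  obtain t' where t': "t' > 0" "\<And>y. y \<in> K \<Longrightarrow> cube y t' \<subseteq> S"
    using compact_cube_margin[OF \<open>compact K\<close> S(1) K(2)] by blast
  \<comment> \<open>Half of the margin is spent on moving from a point of \<open>K\<close> to a
    nearby centre, the other half on the cube about that centre.\<close>
  define t where "t = t' / 2"
  have t: "t > 0" using t' by (simp add: t_def)

  \<comment> \<open>Geometric blocks of indices and their cubes\<close>
  define \<alpha> where "\<alpha> = c1 * \<mu>"
  have \<alpha>: "\<alpha> > 0" using c1 \<mu> by (simp add: \<alpha>_def)
  \<comment> \<open>Earlier blocks hold at most \<open>3 * F\<close> times the sum of the
    \<open>M j\<close>, which is at most \<open>M k / (B - 1)\<close>. The ratio is large enough for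
    \<open>sparse\<close>.\<close>
  obtain B0 :: nat where B0: "4 ^ D * (3 * real F) * 4 / \<alpha> < real B0"
    using reals_Archimedean2 by blast
  define B where "B = B0 + 2"
  have B: "B \<ge> 2" "4 ^ D * (3 * real F) * 4 / \<alpha> \<le> real B - 1" using B0 by (auto simp: B_def)
  have "\<forall>\<^sub>F q in sequentially. inv_root TYPE('n) q < t / C"
    using inv_root_tendsto_0 t C by (intro order_tendstoD) auto
  then obtain q0 where q0: "\<And>q. q \<ge> q0 \<Longrightarrow> inv_root TYPE('n) q < t / C"
    by (auto simp: eventually_sequentially)
  \<comment> \<open>Starting beyond \<open>q0\<close> gives \<open>C * \<delta> k \<le> t\<close>;
    starting beyond \<open>m\<close> makes all indices used at least \<open>m\<close>.\<close>
  define k0 where "k0 = max q0 m"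
  define M where "M = (\<lambda>k. B ^ (k0 + k))"
  define \<delta> where "\<delta> = (\<lambda>k. inv_root TYPE('n) (M k))"
  have M1: "M k \<ge> 1" for k using B(1) by (simp add: M_def)
  have Mk: "M k \<ge> k0" for k
  proof -
    have "k0 + k \<le> 2 ^ (k0 + k)" using less_exp[of "k0 + k"] by simp
    also have "\<dots> \<le> M k" unfolding M_def using B(1) by (intro power_mono) auto
    finally show ?thesis by simp
  qed
  have \<delta>: "\<delta> k > 0" "real (M k) * \<delta> k ^ D = 1" for k
    using inv_root_pos[OF M1, where 'n = 'n] inv_root_pow[OF M1[of k], where 'n = 'n] M1[of k]
    by (auto simp: \<delta>_def D_def)
  have C\<delta>: "C * \<delta> k \<le> t" for k
    using q0[of "M k"] Mk[of k] C by (simp add: k0_def \<delta>_def field_simps)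
  define J where "J = (\<lambda>k. {n \<in> {F * M k..3 * F * M k}. cube (c n) t \<subseteq> S})"
  \<comment> \<open>The radius at the last index is the smallest in the block; dividing by
    \<open>b\<close> puts the cube inside the ball of \<open>N\<close>. The truncation keeps cubes
    of one block disjoint.\<close>
  define \<rho> where "\<rho> = (\<lambda>k. min (r (3 * F * M k) / b) (\<sigma> / 2 * \<delta> k))"
  have finJ: "finite (J k)" for k by (simp add: J_def)
  have \<rho>0: "0 \<le> \<rho> k" for k
  proof -
    have "1 \<le> 3 * F * M k" using F M1[of k] by simp
    then show ?thesis using P_seq_nonneg[OF r, of "3 * F * M k"] b(1) \<sigma> \<delta>(1)[of k]
      by (simp add: \<rho>_def)
  qed
  have \<rho>\<sigma>: "2 * \<rho> k \<le> \<sigma> * \<delta> k" for k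
    using min.cobounded2[of "r (3 * F * M k) / b" "\<sigma> / 2 * \<delta> k"] by (simp add: \<rho>_def)
  have many: "\<alpha> \<le> real (card (J k)) * \<delta> k ^ D" for k
  proof -
    have "K \<subseteq> (\<Union>n\<in>J k. cube (c n) (C * \<delta> k))"
    proof
      fix y assume y: "y \<in> K"
      obtain n p where n: "n \<in> {F * M k..3 * F * M k}"
        and p: "infnorm (y - real n *\<^sub>R x - int_vec p) < C * \<delta> k"
        using cover[OF M1[of k], of y] unfolding C_def \<delta>_def by blast
      \<comment> \<open>The translate \<open>z\<close> is close to \<open>K\<close>, hence in
        \<open>S\<close> and in the unit cube, so it is the term \<open>c n\<close> itself.\<close>
      define z where "z = real n *\<^sub>R x - int_vec (- p)"
      have "y - z = y - real n *\<^sub>R x - int_vec p" by (simp add: z_def int_vec_minus)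
      with p have yz: "infnorm (y - z) < C * \<delta> k" by (simp only:)
      then have zy: "infnorm (z - y) < t" using C\<delta>[of k] infnorm_sub[of z y] by linarith
      have "cube z t \<subseteq> cube y t'" using zy by (intro cube_subset) (simp add: t_def)
      then have zS: "cube z t \<subseteq> S" using t'(2)[OF y] by blast
      moreover have "z \<in> cube z t" using t by (simp add: cube_def infnorm_0)
      ultimately have "z \<in> U" by (auto simp: S_def)
      then have "c n = z" unfolding c_def z_def U_def by (intro frac_vec_unique) auto
      then show "y \<in> (\<Union>n\<in>J k. cube (c n) (C * \<delta> k))"
        using n zS yz by (auto simp: J_def cube_def)
    qed
    then have "measure lebesgue K \<le> measure lebesgue (\<Union>n\<in>J k. cube (c n) (C * \<delta> k))"
      using Km finJ by (intro measure_mono_fmeasurable fmeasurable.finite_UN) (auto simp: fmeasurableD)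
    also have "\<dots> \<le> (\<Sum>n\<in>J k. measure lebesgue (cube (c n) (C * \<delta> k)))"
      using finJ by (intro measure_UNION_le) (auto simp: fmeasurableD)
    also have "\<dots> = real (card (J k)) * \<delta> k ^ D * (2 * C) ^ D"
      using C \<delta>(1)[of k] by (simp add: measure_cube D_def power_mult_distrib)
    finally have "\<mu> / 2 \<le> real (card (J k)) * \<delta> k ^ D * (2 * C) ^ D" using K\<mu> by linarith
    then show ?thesis using C by (simp add: \<alpha>_def c1_def field_simps)
  qed
  have sparse: "4 ^ D * (\<Sum>j<k. real (card (J j))) * \<delta> k ^ D \<le> \<alpha> / 4" for k
  proof -
    have cardJ: "real (card (J j)) \<le> 3 * real F * real (M j)" for j
    proof -
      have "card (J j) \<le> card {F * M j..3 * F * M j}" by (intro card_mono) (auto simp: J_def)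
      also have "\<dots> \<le> 3 * F * M j" using F M1[of j] by simp
      finally have "real (card (J j)) \<le> real (3 * F * M j)" by (simp only: of_nat_le_iff)
      then show ?thesis by simp
    qed
    have geo: "(\<Sum>j<k. real (M j)) * (real B - 1) \<le> real (M k)"
    proof (induction k)
      case (Suc k)
      then show ?case by (simp add: M_def algebra_simps)
    qed (simp add: M_def)
    have "4 ^ D * (\<Sum>j<k. real (card (J j))) * 4 / \<alpha> \<le> 4 ^ D * (\<Sum>j<k. 3 * real F * real (M j)) * 4 / \<alpha>"
      using \<alpha> by (intro divide_right_mono mult_right_mono mult_left_mono sum_mono cardJ) auto
    also have "\<dots> = (\<Sum>j<k. real (M j)) * (4 ^ D * (3 * real F) * 4 / \<alpha>)"
      by (simp add: sum_distrib_left[symmetric])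
    also have "\<dots> \<le> (\<Sum>j<k. real (M j)) * (real B - 1)"
      using B(2) by (intro mult_left_mono sum_nonneg) auto
    also have "\<dots> \<le> real (M k)" by (rule geo)
    finally have "4 ^ D * (\<Sum>j<k. real (card (J j))) \<le> real (M k) * (\<alpha> / 4)"
      using \<alpha> by (simp add: field_simps)
    then have "4 ^ D * (\<Sum>j<k. real (card (J j))) * \<delta> k ^ D \<le> real (M k) * (\<alpha> / 4) * \<delta> k ^ D"
      using \<delta>(1)[of k] by (intro mult_right_mono) auto
    also have "\<dots> = \<alpha> / 4 * (real (M k) * \<delta> k ^ D)" by simp
    also have "\<dots> = \<alpha> / 4" by (simp only: \<delta>(2) mult_1_right)
    finally show ?thesis .
  qed
  have div: "\<not> summable (\<lambda>k. real (card (J k)) * (2 * \<rho> k) ^ D)"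
    unfolding \<rho>_def M_def
    using r F B(1) b(1) \<sigma> \<delta> \<alpha> many
    by (intro not_summable_block_radii[where \<alpha> = \<alpha>]) (auto simp: D_def M_def)
  have "\<exists>k. \<alpha> * (\<sigma> / 2) ^ D / 8 \<le> measure lebesgue (\<Union>j<k. \<Union>n\<in>J j. cube (c n) (\<rho> j))"
    unfolding D_def
  proof (rule greedy_union[where \<delta> = \<delta> and \<sigma> = \<sigma>])
    fix k n l assume "n \<in> J k" "l \<in> J k" "n \<noteq> l"
    then show "\<sigma> * \<delta> k \<le> infnorm (c n - c l)"
      unfolding \<sigma>_def \<delta>_def c_def J_def
      by (intro separation_block[OF x F M1]) auto
  qed (use finJ \<sigma> \<delta>(1) \<rho>0 \<rho>\<sigma> many sparse div in \<open>auto simp: D_def\<close>)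
  then obtain k where "\<alpha> * (\<sigma> / 2) ^ D / 8 \<le> measure lebesgue (\<Union>j<k. \<Union>n\<in>J j. cube (c n) (\<rho> j))"
    by blast
  also have "\<dots> \<le> measure lebesgue (T - V)"
  proof (rule measure_mono_fmeasurable)
    \<comment> \<open>A point of such a cube is within \<open>r n\<close> of \<open>c n\<close> in
      the norm \<open>N\<close> for some \<open>n \<ge> m\<close>, which excludes it from
      \<open>V\<close>.\<close>
    show "(\<Union>j<k. \<Union>n\<in>J j. cube (c n) (\<rho> j)) \<subseteq> T - V"
    proof safe
      fix j n y assume jn: "n \<in> J j" "y \<in> cube (c n) (\<rho> j)"
      have "\<rho> j \<le> C * \<delta> j"
        using \<rho>\<sigma>[of j] \<rho>0[of j] mult_right_mono[OF \<sigma>C, of "\<delta> j"] \<delta>(1)[of j] by linarith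
      then have "\<rho> j \<le> t" using C\<delta>[of j] by linarith
      then have "cube (c n) (\<rho> j) \<subseteq> cube (c n) t" by (auto simp: cube_def)
      then show "y \<in> T" using jn by (auto simp: J_def S_def)
      assume "y \<in> V"
      moreover have "m \<le> n"
      proof -
        have "m \<le> M j" using Mk[of j] by (simp add: k0_def)
        also have "\<dots> \<le> F * M j" using F by simp
        also have "\<dots> \<le> n" using jn by (simp add: J_def)
        finally show ?thesis .
      qed
      ultimately have "r n \<le> N (y - c n)" by (auto simp: V_def c_def)
      also have "\<dots> \<le> b * infnorm (y - c n)" by (rule b(2))
      also have "\<dots> < b * \<rho> j" using jn b(1) by (simp add: cube_def)
      also have "\<dots> \<le> b * (r (3 * F * M j) / b)"
        using b(1) by (intro mult_left_mono) (auto simp: \<rho>_def)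
      also have "\<dots> = r (3 * F * M j)" using b(1) by simp
      also have "\<dots> \<le> r n"
      proof (rule P_seq_antimono[OF r])
        have "1 \<le> F * M j" using F M1[of j] by simp
        also have "\<dots> \<le> n" using jn by (simp add: J_def)
        finally show "1 \<le> n" .
        show "n \<le> 3 * F * M j" using jn by (simp add: J_def)
      qed
      finally show False by simp
    qed
    show "(\<Union>j<k. \<Union>n\<in>J j. cube (c n) (\<rho> j)) \<in> sets lebesgue"
      using finJ by (intro fmeasurableD fmeasurable.finite_UN) auto
  qed (rule T(3))
  finally show False using TV\<mu> by (simp add: \<alpha>_def c2_def ac_simps)
qed

lemma badly_approximable_imp_uniformly_eutaxic:
  fixes N :: "real^'n \<Rightarrow> real" and x :: "real^'n"
  assumes N: "is_norm N" and x: "badly_approximable x"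
  shows "uniformly_eutaxic N (\<lambda>n. frac_vec (real n *\<^sub>R x)) {y. \<forall>i. 0 < y $ i \<and> y $ i < 1}"
  unfolding uniformly_eutaxic_def
proof (intro allI impI)
  fix r assume r: "P_seq CARD('n) r"
  obtain \<epsilon> where \<epsilon>: "bad_approx_const x \<epsilon>" by (rule badly_approximable_imp_bad_approx_const[OF x])
  define V where "V = (\<lambda>m. {y \<in> {y. \<forall>i. 0 < y $ i \<and> y $ i < 1}.
      \<forall>n\<ge>m. r n \<le> N (y - frac_vec (real n *\<^sub>R x))})"
  have "AE y in lebesgue. y \<notin> V m" for m
    unfolding V_def
    by (rule AE_not_in[OF negligible_avoiding_set[OF N \<epsilon> r, of m, unfolded negligible_iff_null_sets]])
  then have "AE y in lebesgue. \<forall>m. y \<notin> V m" by (simp add: AE_all_countable)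
  then show "AE y in lebesgue. y \<in> {y. \<forall>i. 0 < y $ i \<and> y $ i < 1} \<longrightarrow>
      (\<exists>\<^sub>\<infinity>n. 1 \<le> n \<and> N (y - frac_vec (real n *\<^sub>R x)) < r n)"
  proof eventually_elim
    case (elim y)
    show ?case
      unfolding INFM_nat_le
    proof (intro impI allI)
      fix m assume "y \<in> {y. \<forall>i. 0 < y $ i \<and> y $ i < 1}"
      then show "\<exists>n\<ge>m. 1 \<le> n \<and> N (y - frac_vec (real n *\<^sub>R x)) < r n"
        \<comment> \<open>The maximum with 1 supplies the condition
          \<open>1 \<le> n\<close>.\<close>
        using elim[THEN spec, of "max m 1"] by (auto simp: V_def not_le)
    qed
  qed
qed

section \<open>Points that are not badly approximable\<close>

text \<open>The constant is the minimum of \<open>N\<close> on the Euclidean unit sphere, attained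
  by compactness; then \<open>infnorm\<close> is at most the Euclidean norm.\<close>

lemma norm_ge_infnorm_bound:
  fixes N :: "real^'n \<Rightarrow> real"
  assumes N: "is_norm N"
  obtains a where "a > 0" "\<And>v. a * infnorm v \<le> N v"
proof -
  have scale: "N (s *\<^sub>R v) = \<bar>s\<bar> * N v" and pos: "0 \<le> N v" and zero: "N v = 0 \<longleftrightarrow> v = 0" for s v
    using N unfolding is_norm_def by blast+
  have "compact (sphere (0 :: real^'n) 1)" "sphere (0 :: real^'n) 1 \<noteq> {}" by auto
  from continuous_attains_inf[OF this continuous_on_is_norm[OF N]]
  obtain u where u: "u \<in> sphere 0 1" "\<And>v. v \<in> sphere 0 1 \<Longrightarrow> N u \<le> N v" by blast
  have "N u * infnorm v \<le> N v" for v
  proof (cases "v = 0")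
    case False
    have "N u * infnorm v \<le> N u * norm v"
      using pos infnorm_le_norm by (rule mult_left_mono[rotated])
    also have "\<dots> \<le> N ((1 / norm v) *\<^sub>R v) * norm v"
      using False by (intro mult_right_mono u) auto
    also have "\<dots> = N v" using False by (simp add: scale)
    finally show ?thesis .
  qed (use pos in \<open>simp add: infnorm_0\<close>)
  moreover have "N u > 0" using u(1) pos[of u] zero[of u] by (auto simp: less_le)
  ultimately show thesis by (rule that[rotated])
qed

text \<open>Failure of bad approximability only yields some \<open>q \<ge> 1\<close>. Passing to
  \<open>j * q\<close> multiplies the error by \<open>j\<close> and shrinks the scale by at most
  \<open>j\<close>, so one starts from \<open>e / j ^ 2\<close>.\<close>

lemma not_badly_approximable_large:
  fixes x :: "real^'n"
  assumes x: "\<not> badly_approximable x" and "e > 0"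
  shows "\<exists>q\<ge>Q. q \<ge> 1 \<and> (\<exists>p. infnorm (real q *\<^sub>R x - int_vec p) < e * inv_root TYPE('n) q)"
proof -
  define j where "j = max Q 1"
  have j: "j \<ge> 1" "j \<ge> Q" by (auto simp: j_def)
  have "e / real j ^ 2 > 0" using assms(2) j by simp
  then obtain q p where q: "q \<ge> 1"
    and p: "infnorm (real q *\<^sub>R x - int_vec p) < e / real j ^ 2 * inv_root TYPE('n) q"
    using x unfolding badly_approximable_iff not_ex not_all not_le by (metis not_le)
  have "real (j * q) *\<^sub>R x - int_vec (\<chi> i. int j * p $ i) = real j *\<^sub>R (real q *\<^sub>R x - int_vec p)"
    by (simp add: int_vec_scale scaleR_diff_right)
  then have "infnorm (real (j * q) *\<^sub>R x - int_vec (\<chi> i. int j * p $ i))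
      = real j * infnorm (real q *\<^sub>R x - int_vec p)"
    by (simp only: infnorm_mul abs_of_nat)
  also have "\<dots> < real j * (e / real j ^ 2 * inv_root TYPE('n) q)"
    using p j by (intro mult_strict_left_mono) auto
  also have "\<dots> = e * (1 / real j) * inv_root TYPE('n) q"
    using j by (simp add: power2_eq_square)
  also have "\<dots> \<le> e * inv_root TYPE('n) j * inv_root TYPE('n) q"
    using assms(2) inv_root_ge_inverse[OF j(1), where 'n = 'n] inv_root_pos[OF q, where 'n = 'n]
    by (intro mult_right_mono mult_left_mono) auto
  also have "\<dots> = e * inv_root TYPE('n) (j * q)" by (simp add: inv_root_mult)
  finally have "infnorm (real (j * q) *\<^sub>R x - int_vec (\<chi> i. int j * p $ i)) < e * inv_root TYPE('n) (j * q)" .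
  moreover have "j * q \<ge> j" using q by simp
  then have "j * q \<ge> Q" "j * q \<ge> 1" using j by linarith+
  ultimately show ?thesis by blast
qed

lemma finite_bounded_int_vectors: "finite {p :: int^'n. \<forall>i. \<bar>p $ i\<bar> \<le> b}"
proof (rule finite_subset)
  show "{p :: int^'n. \<forall>i. \<bar>p $ i\<bar> \<le> b} \<subseteq> vec_lambda ` (UNIV \<rightarrow>\<^sub>E {-b..b})"
  proof
    fix p :: "int^'n" assume "p \<in> {p. \<forall>i. \<bar>p $ i\<bar> \<le> b}"
    then have "($) p \<in> UNIV \<rightarrow>\<^sub>E {-b..b}" by (auto simp: abs_le_iff PiE_UNIV_domain) (smt (verit))
    then show "p \<in> vec_lambda ` (UNIV \<rightarrow>\<^sub>E {-b..b})" by (metis image_eqI vec_nth_inverse)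
  qed
  show "finite (vec_lambda ` ((UNIV :: 'n set) \<rightarrow>\<^sub>E {-b..b}))"
    by (intro finite_imageI finite_PiE) auto
qed

text \<open>The sequence takes the value \<open>h k\<close> from \<open>m (k - 1) + 1\<close> to
  \<open>m k\<close>. By doubling, that block has at least \<open>m k / 2\<close> indices, so each
  block after the first adds at least \<open>1 / 2\<close> to the sum of \<open>d\<close>-th
  powers.\<close>

lemma block_sequence_P_seq:
  fixes h :: "nat \<Rightarrow> real" and m :: "nat \<Rightarrow> nat" and d :: nat
  assumes m: "\<And>k. 2 * m k \<le> m (Suc k)" "m 0 \<ge> 1"
    and h: "\<And>k. h (Suc k) \<le> h k" "\<And>k. 0 \<le> h k" "h \<longlonglongrightarrow> 0"
    and mass: "\<And>k. 1 \<le> real (m k) * h k ^ d"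
  defines "blk \<equiv> \<lambda>n. LEAST k. n \<le> m k"
  shows "P_seq d (\<lambda>n. h (blk n))" and "\<And>n. n \<le> m (blk n)" and "\<And>k n. m k < n \<Longrightarrow> k < blk n"
proof -
  have mpos: "1 \<le> m k" for k
  proof (induction k)
    case (Suc k) then show ?case using m(1)[of k] by linarith
  qed (rule m(2))
  have mless: "m k < m (Suc k)" for k using m(1)[of k] mpos[of k] by linarith
  then have sm: "strict_mono m" by (rule strict_monoI_Suc)
  show blk: "n \<le> m (blk n)" for n
    unfolding blk_def by (rule LeastI[of _ n]) (rule strict_mono_imp_increasing[OF sm])
  have blk_le: "blk n \<le> k" if "n \<le> m k" for n k
    unfolding blk_def using that by (rule Least_le)
  show gt: "m k < n \<Longrightarrow> k < blk n" for k n
    using blk[of n] strict_mono_less_eq[OF sm, of "blk n" k] by linarith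
  have blk_mono: "blk n \<le> blk (Suc n)" for n
    using blk[of "Suc n"] by (intro blk_le) simp
  have hanti: "decseq h" using h(1) by (rule decseq_SucI)
  have blk_at_top: "filterlim blk at_top sequentially"
    unfolding filterlim_at_top eventually_sequentially
  proof
    fix Z show "\<exists>n0. \<forall>n\<ge>n0. Z \<le> blk n"
      using gt[of Z] by (intro exI[of _ "Suc (m Z)"]) (auto simp: Suc_le_eq intro: less_imp_le)
  qed
  have "\<not> summable (\<lambda>n. h (blk (Suc n)) ^ d)"
  proof
    assume "summable (\<lambda>n. h (blk (Suc n)) ^ d)"
    then have s: "summable (\<lambda>n. h (blk n) ^ d)" using summable_Suc_iff[of "\<lambda>n. h (blk n) ^ d"] by simp
    have "real k / 2 \<le> (\<Sum>n\<le>m k. h (blk n) ^ d)" for k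
    proof (induction k)
      case (Suc k)
      have "1 / 2 \<le> real (m (Suc k)) / 2 * h (Suc k) ^ d" using mass[of "Suc k"] by simp
      also have "\<dots> \<le> real (card {m k<..m (Suc k)}) * h (Suc k) ^ d"
        using m(1)[of k] h(2)[of "Suc k"] by (intro mult_right_mono) auto
      also have "\<dots> = (\<Sum>n\<in>{m k<..m (Suc k)}. h (Suc k) ^ d)" by simp
      also have "\<dots> = (\<Sum>n\<in>{m k<..m (Suc k)}. h (blk n) ^ d)"
      proof (rule sum.cong)
        fix n assume "n \<in> {m k<..m (Suc k)}"
        then have "blk n = Suc k" using gt[of k n] blk_le[of n "Suc k"] by simp
        then show "h (Suc k) ^ d = h (blk n) ^ d" by simp
      qed simp
      finally have "1 / 2 \<le> (\<Sum>n\<in>{m k<..m (Suc k)}. h (blk n) ^ d)" .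
      moreover have "{..m (Suc k)} = {..m k} \<union> {m k<..m (Suc k)}"
        using mless[of k] by auto
      then have "(\<Sum>n\<le>m (Suc k). h (blk n) ^ d)
          = (\<Sum>n\<le>m k. h (blk n) ^ d) + (\<Sum>n\<in>{m k<..m (Suc k)}. h (blk n) ^ d)"
        by (simp only:) (rule sum.union_disjoint, auto)
      ultimately show ?case using Suc by simp
    qed (simp add: sum_nonneg h(2))
    moreover have "(\<Sum>n\<le>m k. h (blk n) ^ d) \<le> (\<Sum>n. h (blk n) ^ d)" for k
      using s h(2) by (intro sum_le_suminf) auto
    ultimately have le: "real k / 2 \<le> (\<Sum>n. h (blk n) ^ d)" for k by (rule order_trans)
    obtain k :: nat where "2 * (\<Sum>n. h (blk n) ^ d) < real k"
      using reals_Archimedean2 by blast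
    with le[of k] show False by linarith
  qed
  then show "P_seq d (\<lambda>n. h (blk n))"
    unfolding P_seq_def using decseqD[OF hanti blk_mono] filterlim_compose[OF h(3) blk_at_top]
    by auto
qed

lemma uniformly_eutaxic_imp_badly_approximable:
  fixes N :: "real^'n \<Rightarrow> real" and x :: "real^'n"
  assumes N: "is_norm N"
    and eut: "uniformly_eutaxic N (\<lambda>n. frac_vec (real n *\<^sub>R x)) {y. \<forall>i. 0 < y $ i \<and> y $ i < 1}"
  shows "badly_approximable x"
proof (rule ccontr)
  assume nba: "\<not> badly_approximable x"
  define D where "D = CARD('n)"
  define U where "U = {y :: real^'n. \<forall>i. 0 < y $ i \<and> y $ i < 1}"
  have D: "D \<ge> 1" by (simp add: D_def Suc_leI)
  obtain a where a: "a > 0" "\<And>v. a * infnorm v \<le> N v"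
    using norm_ge_infnorm_bound[OF N] by blast
  \<comment> \<open>Up to \<open>2 ^ (D * k)\<close> steps of length \<open>q k\<close> then drift
    by at most \<open>h k\<close> modulo 1, no more than the radius in use.\<close>
  define e :: "nat \<Rightarrow> real" where "e = (\<lambda>k. (1 / 2) ^ k / (2 ^ D) ^ k)"
  have e: "e k > 0" for k by (simp add: e_def)
  define good where "good = (\<lambda>k q. q \<ge> 1 \<and>
    (\<exists>p. infnorm (real q *\<^sub>R x - int_vec p) < e k * inv_root TYPE('n) q))"
  have ex: "\<exists>q\<ge>Q. good k q" for k Q
    using not_badly_approximable_large[OF nba e, of Q k] by (auto simp: good_def)
  \<comment> \<open>Monotone denominators make \<open>h\<close> decreasing and let \<open>m\<close>
    at least double.\<close>
  have "\<exists>q. \<forall>k. good k (q k) \<and> q k \<le> q (Suc k)"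
    using ex by (intro dependent_nat_choice) blast+
  then obtain q where q: "\<And>k. good k (q k)" "\<And>k. q k \<le> q (Suc k)" by blast
  have q1: "q k \<ge> 1" for k using q(1)[of k] by (simp add: good_def)
  have "\<forall>k. \<exists>p. infnorm (real (q k) *\<^sub>R x - int_vec p) < e k * inv_root TYPE('n) (q k)"
    using q(1) by (simp add: good_def)
  then obtain p where p: "\<And>k. infnorm (real (q k) *\<^sub>R x - int_vec (p k)) < e k * inv_root TYPE('n) (q k)"
    by metis

  \<comment> \<open>Block radii with divergent sum\<close>
  define h where "h = (\<lambda>k. (1 / 2) ^ k * inv_root TYPE('n) (q k))"
  define m where "m = (\<lambda>k. (2 ^ D) ^ k * q k)"
  define blk where "blk = (\<lambda>n. LEAST k. n \<le> m k)"
  have root_le1: "inv_root TYPE('n) (q k) \<le> 1" for k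
    using inv_root_antimono[of 1 "q k", where 'n = 'n] q1[of k] by (simp add: inv_root_def)
  have root_pos: "0 < inv_root TYPE('n) (q k)" for k by (rule inv_root_pos[OF q1])
  have h0: "0 \<le> h k" for k using root_pos[of k] by (simp add: h_def)
  have hle: "h k \<le> (1 / 2) ^ k" for k
    using root_le1[of k] by (simp add: h_def mult_left_le)
  have m2: "2 * m k \<le> m (Suc k)" for k
  proof -
    have "2 * 1 \<le> (2 :: nat) * 2 ^ (D - 1)" by (intro mult_le_mono2) simp
    also have "\<dots> = 2 ^ D" using D by (simp flip: power_Suc)
    finally have "2 * ((2 ^ D) ^ k * q k) \<le> 2 ^ D * ((2 ^ D) ^ k * q (Suc k))"
      using q(2)[of k] by (intro mult_mono) auto
    then show ?thesis by (simp add: m_def)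
  qed
  have m0: "m 0 \<ge> 1" using q1[of 0] by (simp add: m_def)
  have h_Suc: "h (Suc k) \<le> h k" for k
  proof -
    have "(1 / 2 :: real) ^ Suc k * inv_root TYPE('n) (q (Suc k)) \<le> (1 / 2) ^ k * inv_root TYPE('n) (q k)"
      using inv_root_antimono[OF q1 q(2), where 'n = 'n] root_pos[of "Suc k"]
      by (intro mult_mono) (auto intro: less_imp_le)
    then show ?thesis by (simp only: h_def)
  qed
  have h_lim: "h \<longlonglongrightarrow> 0"
    by (rule tendsto_sandwich[OF always_eventually always_eventually tendsto_const LIMSEQ_realpow_zero])
      (auto simp: h0 intro: hle)
  have mass: "1 \<le> real (m k) * h k ^ D" for k
  proof -
    have "real (m k) * h k ^ D = ((2 ^ D) ^ k * ((1 / 2) ^ k) ^ D) * (real (q k) * inv_root TYPE('n) (q k) ^ D)"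
      by (simp add: m_def h_def power_mult_distrib)
    also have "((2 :: real) ^ D) ^ k * ((1 / 2) ^ k) ^ D = 1"
      by (simp add: power_mult[symmetric] mult.commute[of k D] flip: power_mult_distrib)
    also have "real (q k) * inv_root TYPE('n) (q k) ^ D = 1"
      using q1[of k] inv_root_pow[OF q1[of k], where 'n = 'n] by (simp add: D_def)
    finally show ?thesis by simp
  qed
  note block = block_sequence_P_seq[where m = m and h = h and d = D, OF m2 m0 h_Suc h0 h_lim mass]
  have P: "P_seq D (\<lambda>n. h (blk n))"
    unfolding blk_def by (rule block(1))
  have blk: "n \<le> m (blk n)" "m k < n \<Longrightarrow> k < blk n" for k n
    unfolding blk_def by (rule block(2), rule block(3))

  \<comment> \<open>\<open>h k / a\<close> covers the ball of \<open>N\<close>, and a further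
    \<open>h k\<close> covers the drift along the cluster.\<close>
  define R where "R = (\<lambda>k. (1 / a + 1) * h k)"
  have R0: "0 \<le> R k" for k using a h0[of k] by (simp add: R_def)
  have Rle: "R k \<le> 1 / a + 1" for k
    using hle[of k] power_le_one[of "1/2 :: real" k] a by (simp add: R_def mult_left_le)
  \<comment> \<open>Large enough for every integer translate that can bring a cluster point near the
    unit cube, so finitely many suffice.\<close>
  define b :: int where "b = \<lceil>1 / a + 3\<rceil>"
  define G where "G = {p :: int^'n. \<forall>i. \<bar>p $ i\<bar> \<le> b}"
  have finG: "finite G" unfolding G_def by (rule finite_bounded_int_vectors)
  \<comment> \<open>Only \<open>q k\<close> centres per translate instead of \<open>m k\<close>:
    this gains the factor \<open>2 ^ (D * k)\<close> that makes the measures summable.\<close>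
  define E where "E = (\<lambda>k. \<Union>i<q k. \<Union>g\<in>G. cube (frac_vec (real i *\<^sub>R x) + int_vec g) (R k))"
  have E_meas: "E k \<in> lmeasurable" for k
    unfolding E_def using finG by (intro fmeasurable.finite_UN) auto
  have E_le: "measure lebesgue (E k) \<le> real (card G) * (2 * (1 / a + 1)) ^ D * ((1 / 2) ^ D) ^ k" for k
  proof -
    have "measure lebesgue (E k) \<le> (\<Sum>i<q k. measure lebesgue (\<Union>g\<in>G. cube (frac_vec (real i *\<^sub>R x) + int_vec g) (R k)))"
      unfolding E_def using finG by (intro measure_UNION_le fmeasurableD fmeasurable.finite_UN) auto
    also have "\<dots> \<le> (\<Sum>i<q k. \<Sum>g\<in>G. measure lebesgue (cube (frac_vec (real i *\<^sub>R x) + int_vec g) (R k)))"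
      using finG by (intro sum_mono measure_UNION_le fmeasurableD) auto
    also have "\<dots> = real (card G) * (real (q k) * (2 * R k) ^ D)"
      using R0[of k] by (simp add: measure_cube D_def)
    also have "(2 * R k) ^ D = (2 * (1 / a + 1)) ^ D * ((1 / 2) ^ k) ^ D * inv_root TYPE('n) (q k) ^ D"
      unfolding R_def h_def by (simp only: power_mult_distrib mult.assoc)
    also have "((1 / 2 :: real) ^ k) ^ D = ((1 / 2) ^ D) ^ k"
      by (simp only: power_mult[symmetric] mult.commute)
    also have "inv_root TYPE('n) (q k) ^ D = 1 / real (q k)"
      unfolding D_def by (rule inv_root_pow[OF q1])
    finally show ?thesis using q1[of k] by simp
  qed
  have "summable (\<lambda>k. real (card G) * (2 * (1 / a + 1)) ^ D * ((1 / 2) ^ D) ^ k)"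
    using D by (intro summable_mult summable_geometric) (simp add: power_less_one_iff)
  then have "summable (\<lambda>k. measure lebesgue (E k))"
    by (rule summable_comparison_test'[where N = 0]) (use E_le in auto)
  then have BC: "AE y in lebesgue. \<forall>\<^sub>F k in sequentially. y \<in> space lebesgue - E k"
    using fmeasurableD[OF E_meas] fmeasurableD2[OF E_meas]
    by (intro borel_cantelli_AE1) (simp_all add: less_top del: emeasure_completion)

  have cover: "y \<in> E (blk n)" if y: "y \<in> U" and n: "N (y - frac_vec (real n *\<^sub>R x)) < h (blk n)" for y n
  proof -
    define k where "k = blk n"
    \<comment> \<open>Division by \<open>q k\<close> writes \<open>n\<close> as a base index
      \<open>i\<close> plus \<open>j\<close> nearly periodic steps.\<close>
    define j where "j = n div q k"
    define i where "i = n mod q k"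
    have n_eq: "n = i + j * q k" by (simp add: i_def j_def)
    have i: "i < q k" using q1[of k] by (simp add: i_def)
    have "n \<le> m k" using blk(1)[of n] by (simp add: k_def)
    then have "j \<le> m k div q k" unfolding j_def by (rule div_le_mono)
    then have j: "j \<le> (2 ^ D) ^ k" using q1[of k] by (simp add: m_def)
    obtain p1 where p1: "frac_vec (real n *\<^sub>R x) = real n *\<^sub>R x - int_vec p1"
      by (rule frac_vec_obtain)
    obtain p2 where p2: "frac_vec (real i *\<^sub>R x) = real i *\<^sub>R x - int_vec p2"
      by (rule frac_vec_obtain)
    define w where "w = real (q k) *\<^sub>R x - int_vec (p k)"
    \<comment> \<open>Collects the integer parts of both orbit points and the integer vector picked
      up in the \<open>j\<close> steps.\<close>
    define g where "g = p2 - p1 + (\<chi> l. int j * p k $ l)"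
    define v where "v = y - (frac_vec (real i *\<^sub>R x) + int_vec g)"
    have "real n *\<^sub>R x = real i *\<^sub>R x + real j *\<^sub>R (real (q k) *\<^sub>R x)"
      by (simp add: n_eq scaleR_add_left)
    then have frac_n: "frac_vec (real n *\<^sub>R x) = frac_vec (real i *\<^sub>R x) + int_vec g + real j *\<^sub>R w"
      unfolding p1 p2 g_def w_def
      by (simp add: int_vec_add int_vec_diff int_vec_scale scaleR_diff_right)
    have "a * infnorm (y - frac_vec (real n *\<^sub>R x)) < h k"
      using a(2)[of "y - frac_vec (real n *\<^sub>R x)"] n by (simp add: k_def)
    then have near: "infnorm (y - frac_vec (real n *\<^sub>R x)) < 1 / a * h k"
      using a(1) by (simp add: field_simps)
    have "real j * infnorm w \<le> real ((2 ^ D) ^ k) * (e k * inv_root TYPE('n) (q k))"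
      using p[of k] j by (intro mult_mono) (auto simp: w_def infnorm_pos_le simp del: of_nat_power)
    also have "\<dots> = h k" by (simp add: h_def e_def)
    finally have jw: "infnorm (real j *\<^sub>R w) \<le> h k" by (simp add: infnorm_mul)
    have "v = (y - frac_vec (real n *\<^sub>R x)) + real j *\<^sub>R w"
      by (simp add: v_def frac_n)
    then have "infnorm v \<le> infnorm (y - frac_vec (real n *\<^sub>R x)) + infnorm (real j *\<^sub>R w)"
      by (simp only: infnorm_triangle)
    with near jw have v: "infnorm v < R k" by (simp add: R_def algebra_simps)
    have "\<bar>g $ l\<bar> \<le> b" for l
    proof -
      have "\<bar>v $ l\<bar> \<le> 1 / a + 1"
        using component_le_infnorm_cart[of v l] v Rle[of k] by linarith
      moreover have "of_int (g $ l) = y $ l - frac (real i * x $ l) - v $ l"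
        by (simp add: v_def int_vec_def frac_vec_def)
      moreover have "0 < y $ l" "y $ l < 1" using y by (auto simp: U_def)
      moreover have "0 \<le> frac (real i * x $ l)" "frac (real i * x $ l) < 1"
        by (auto simp: frac_lt_1)
      moreover have "1 / a + 3 \<le> of_int b" by (simp add: b_def)
      ultimately have "\<bar>real_of_int (g $ l)\<bar> \<le> real_of_int b" by linarith
      then show ?thesis by linarith
    qed
    then have "g \<in> G" by (simp add: G_def)
    moreover have "y \<in> cube (frac_vec (real i *\<^sub>R x) + int_vec g) (R k)"
      using v by (simp add: cube_def v_def)
    ultimately show ?thesis using i by (auto simp: E_def k_def)
  qed

  have "AE y in lebesgue. y \<in> U \<longrightarrow> (\<exists>\<^sub>\<infinity>n. 1 \<le> n \<and> N (y - frac_vec (real n *\<^sub>R x)) < h (blk n))"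
    using eut P unfolding uniformly_eutaxic_def U_def D_def by blast
  then have "AE y in lebesgue. y \<notin> U"
    using BC
  proof eventually_elim
    case (elim y)
    show ?case
    proof
      assume y: "y \<in> U"
      obtain k0 where k0: "\<And>k. k \<ge> k0 \<Longrightarrow> y \<notin> E k"
        using elim(2) by (auto simp: eventually_sequentially)
      \<comment> \<open>An index beyond \<open>m k0\<close> lies in a block after \<open>k0\<close>,
        where \<open>y\<close> has left all \<open>E k\<close>.\<close>
      obtain n where n: "n > m k0" "N (y - frac_vec (real n *\<^sub>R x)) < h (blk n)"
        using elim(1) y unfolding INFM_nat by blast
      then have "k0 \<le> blk n" using blk(2) by (simp add: less_imp_le)
      with k0 cover[OF y n(2)] show False by blast
    qed
  qed
  moreover have "open U" unfolding U_def by (rule open_unit_cube)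
  moreover have "vec (1 / 2) \<in> U" by (simp add: U_def)
  ultimately show False
    using open_not_negligible[of U] by (auto simp: negligible_iff_null_sets AE_iff_null_sets borel_open)
qed

theorem theorem11p6:
  fixes N :: "real^'n \<Rightarrow> real" and x :: "real^'n"
  assumes "is_norm N"
  shows "uniformly_eutaxic N (\<lambda>n. frac_vec (real n *\<^sub>R x)) {y. \<forall>i. 0 < y $ i \<and> y $ i < 1}
         \<longleftrightarrow> badly_approximable x"
  using assms badly_approximable_imp_uniformly_eutaxic uniformly_eutaxic_imp_badly_approximable
  by blast

end
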